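(* Let $a\ge 2$, $b\ge 2$ and $i\ge 0$ be integers. Then the following three sets are in bijection (in particular they have the same cardinality): (1) $\operatorname{Skyt}(a,i,b)$; (2) $\operatorname{Dyck}(a+b+2i-2,\,i+1,\,b-2)$; (3) $\operatorname{Tri}(a+b+2i,\,i+1,\,b-2)$.
   Context: Skew tableaux. For partitions $\mu\subseteq\lambda$ (written as weakly decreasing lists of row lengths, $x^t$ meaning $x$ repeated $t$ times), the skew diagram $\lambda/\mu$ consists of the boxes of the left-justified Young diagram of $\lambda$ (rows numbered top to bottom) not in that of $\mu$. A standard filling of a skew diagram with $N$ boxes uses each of $1,\dots,N$ exactly once, with rows strictly increasing left to right and columns increasing top to bottom. $\operatorname{Skyt}(a,i,b)$ is the set of standard fillings of the skew shape $[(i+1)^b,1^{a-2}]/[i^{b-2}]$; concretely, rows $1,\dots,b-2$ each contain a single box in column $i+1$, rows $b-1$ and $b$ contain boxes in columns $1,\dots,i+1$, and rows $b+1,\dots,b+a-2$ each contain a single box in column $1$ (so the first column has $a$ boxes, the last column has $b$ boxes, and there are $a+b+2i-2$ boxes in total). Dyck paths. A Dyck path of semi-length $n$ is a word in $\{\mathsf U,\mathsf D\}^{2n}$ with $n$ letters of each kind such that every initial segment contains at least as many $\mathsf U$'s as $\mathsf D$'s. An ascent is a maximal run of consecutive $\mathsf U$'s; it is a long ascent if it has length at least $2$ and a singleton if it has length $1$. $\operatorname{Dyck}(n,\ell,s)$ is the set of Dyck paths of semi-length $n$ with exactly $\ell$ long ascents and exactly $s$ singletons, such that no singleton occurs after the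 last long ascent. Triangulations. Polygons with $n$ vertices have vertices labeled $1,\dots,n$ counterclockwise. A triangulation is a subdivision of the polygon into triangles by non-crossing diagonals. For a vertex $x$ of a triangulation, the fan at $x$ is the maximal collection of triangles all containing $x$ ($x$ is its origin); a fan is singular if it consists of a single triangle. The fan sequence $\mathcal F(T)$ is defined recursively: if $T$ is a single edge, $\mathcal F(T)$ is empty; otherwise let $F$ be the fan at the vertex of $T$ with smallest label, delete that vertex and all edges incident to it, obtaining triangulated polygons (possibly single edges) $T_1,\dots,T_k$ (keeping their labels), arranged counterclockwise so that consecutive ones share exactly one vertex, and set $\mathcal F(T)=(F,\mathcal F(T_1),\dots,\mathcal F(T_k))$ (concatenated). $\operatorname{Tri}(n,t,s)$ is the set of triangulations $T$ of an $n$-gon such that $\mathcal F(T)$ consists of $s+t$ fans, exactly $s$ of which are singular, and the last fan of $\mathcal F(T)$ is not singular. *)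

theory Defs
  imports Main "HOL-Library.FuncSet"
begin

text \<open>Boxes are pairs (row, column), both counted from 1; partitions are lists of row lengths.\<close>

definition young_diagram :: "nat list \<Rightarrow> (nat \<times> nat) set" where
  "young_diagram la = {(r, c). 1 \<le> r \<and> r \<le> length la \<and> 1 \<le> c \<and> c \<le> la ! (r - 1)}"

definition skew_diagram :: "nat list \<Rightarrow> nat list \<Rightarrow> (nat \<times> nat) set" where
  "skew_diagram la mu = young_diagram la - young_diagram mu"

text \<open>Fillings are extensional functions, so that distinct functions are distinct fillings.\<close>

definition standard_fillings :: "(nat \<times> nat) set \<Rightarrow> (nat \<times> nat \<Rightarrow> nat) set" where
  "standard_fillings S = {f \<in> extensional S.
     bij_betw f S {1..card S} \<and>
     (\<forall>r c c'. (r, c) \<in> S \<and> (r, c') \<in> S \<and> c < c' \<longrightarrow> f (r, c) < f (r, c')) \<and>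
     (\<forall>r r' c. (r, c) \<in> S \<and> (r', c) \<in> S \<and> r < r' \<longrightarrow> f (r, c) < f (r', c))}"

definition Skyt :: "nat \<Rightarrow> nat \<Rightarrow> nat \<Rightarrow> (nat \<times> nat \<Rightarrow> nat) set" where
  "Skyt a i b = standard_fillings
     (skew_diagram (replicate b (i + 1) @ replicate (a - 2) 1) (replicate (b - 2) i))"

datatype step = U | D

definition dyck_paths :: "nat \<Rightarrow> step list set" where
  "dyck_paths n = {w. length w = 2 * n \<and> count_list w U = n \<and> count_list w D = n \<and>
     (\<forall>k \<le> length w. count_list (take k w) D \<le> count_list (take k w) U)}"

text \<open>An ascent is recorded as the pair of its starting position and its length.\<close>

definition ascents :: "step list \<Rightarrow> (nat \<times> nat) set" where
  "ascents w = {(p, k). 1 \<le> k \<and> p + k \<le> length w \<and>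
     (\<forall>j. p \<le> j \<and> j < p + k \<longrightarrow> w ! j = U) \<and>
     (p = 0 \<or> w ! (p - 1) = D) \<and>
     (p + k = length w \<or> w ! (p + k) = D)}"

definition long_ascents :: "step list \<Rightarrow> (nat \<times> nat) set" where
  "long_ascents w = {(p, k) \<in> ascents w. 2 \<le> k}"

definition singletons :: "step list \<Rightarrow> (nat \<times> nat) set" where
  "singletons w = {(p, k) \<in> ascents w. k = 1}"

definition Dyck :: "nat \<Rightarrow> nat \<Rightarrow> nat \<Rightarrow> step list set" where
  "Dyck n l s = {w \<in> dyck_paths n.
     card (long_ascents w) = l \<and> card (singletons w) = s \<and>
     \<not> (\<exists>(p, k) \<in> singletons w. \<forall>(q, m) \<in> long_ascents w. q < p)}"

text \<open>
  A convex polygon is given by its finite set of vertex labels, whose counterclockwise order is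
  the cyclic order induced by the order on the labels. The second disjunct below is the side
  joining the largest label to the smallest.
\<close>

definition polygon_sides :: "nat set \<Rightarrow> nat set set" where
  "polygon_sides V = {{u, v} | u v. u \<in> V \<and> v \<in> V \<and> u < v \<and>
     (V \<inter> {u<..<v} = {} \<or> V \<subseteq> {u..v})}"

definition polygon_diagonals :: "nat set \<Rightarrow> nat set set" where
  "polygon_diagonals V = {{u, v} | u v. u \<in> V \<and> v \<in> V \<and> u < v} - polygon_sides V"

definition noncrossing :: "nat set set \<Rightarrow> bool" where
  "noncrossing A \<longleftrightarrow>
     \<not> (\<exists>a b c d. a < b \<and> b < c \<and> c < d \<and> {a, c} \<in> A \<and> {b, d} \<in> A)"

text \<open>
  A polygon subdivided by non-crossing diagonals is represented by the set of all its edges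
  (sides and diagonals). Its regions, given by their vertex sets, are the polygons bounded by
  edges and not subdivided any further by an edge.
\<close>

definition regions :: "nat set set \<Rightarrow> nat set set" where
  "regions T = {C. C \<subseteq> \<Union>T \<and> finite C \<and> 3 \<le> card C \<and>
     polygon_sides C \<subseteq> T \<and> polygon_diagonals C \<inter> T = {}}"

definition triangulations :: "nat set \<Rightarrow> nat set set set" where
  "triangulations V = {polygon_sides V \<union> A | A. A \<subseteq> polygon_diagonals V \<and> noncrossing A \<and>
     (\<forall>C \<in> regions (polygon_sides V \<union> A). card C = 3)}"

definition fan :: "nat set set \<Rightarrow> nat \<Rightarrow> nat set set" where
  "fan T x = {C \<in> regions T. x \<in> C}"

definition singular :: "nat set set \<Rightarrow> bool" where
  "singular F \<longleftrightarrow> card F = 1"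

definition delete_vertex :: "nat \<Rightarrow> nat set set \<Rightarrow> nat set set" where
  "delete_vertex x T = {e \<in> T. x \<notin> e}"

text \<open>
  If \<open>x\<close> is the smallest label and \<open>v\<^sub>0 < \<dots> < v\<^sub>k\<close> are the neighbours of \<open>x\<close>, then
  the polygons left after deleting \<open>x\<close> are, counterclockwise, those on the labels between
  \<open>v\<^sub>j\<^sub>-\<^sub>1\<close> and \<open>v\<^sub>j\<close> for \<open>j = 1, \<dots>, k\<close>.
\<close>

definition subpolygons :: "nat \<Rightarrow> nat set set \<Rightarrow> nat set set list" where
  "subpolygons x T =
     (let vs = sorted_list_of_set {y. {x, y} \<in> T}
      in map (\<lambda>(u, v). {e \<in> delete_vertex x T. e \<subseteq> {u..v}}) (zip vs (tl vs)))"

text \<open>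
  A triangulated polygon is a single edge iff it has at most one edge; the finiteness
  condition only makes the recursion total.
\<close>

function fan_sequence :: "nat set set \<Rightarrow> nat set set list" where
  "fan_sequence T =
     (if finite (\<Union>T) \<and> 1 < card T
      then fan T (Min (\<Union>T)) # concat (map fan_sequence (subpolygons (Min (\<Union>T)) T))
      else [])"
  by pat_completeness auto
termination
proof (relation "measure card", goal_cases)
  case 1
  show ?case by simp
next
  case (2 T T')
  then have fin: "finite (\<Union>T)" and card: "1 < card T" by auto
  have "finite T" using fin by (rule finite_UnionD)
  have "\<Union>T \<noteq> {}"
  proof
    assume "\<Union>T = {}"
    then have "T \<subseteq> {{}}" by auto
    then have "card T \<le> card {{} :: nat set}" by (intro card_mono) auto
    with card show False by simp
  qed
  with fin have "Min (\<Union>T) \<in> \<Union>T" by (rule Min_in)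
  then obtain e where e: "e \<in> T" "Min (\<Union>T) \<in> e" by blast
  from 2 have "T' \<subseteq> delete_vertex (Min (\<Union>T)) T"
    by (auto simp: subpolygons_def Let_def)
  with e have "T' \<subset> T" by (auto simp: delete_vertex_def)
  with \<open>finite T\<close> show ?case by (simp add: psubset_card_mono)
qed

declare fan_sequence.simps [simp del]

definition Tri :: "nat \<Rightarrow> nat \<Rightarrow> nat \<Rightarrow> nat set set set" where
  "Tri n t s = {T \<in> triangulations {1..n}.
     length (fan_sequence T) = s + t \<and>
     length (filter singular (fan_sequence T)) = s \<and>
     \<not> singular (last (fan_sequence T))}"

end

theory Submission imports Defs begin

text \<open>
  All three sets are matched with Lukasiewicz words, that is, words \<open>k\<^sub>1 \<dots> k\<^sub>n\<close> of naturals whose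
  partial sums of \<open>k\<^sub>j - 1\<close> are nonnegative with total 0.

  A Dyck path is \<open>U^k\<^sub>1 D U^k\<^sub>2 D \<dots>\<close>, so the nonzero letters are the ascent lengths in order.

  A triangulation of \<open>x..m\<close> is cut by the triangle \<open>x, y, m\<close> on the side \<open>x, m\<close> into triangulations of
  \<open>x..y\<close> and \<open>y..m\<close>. In the resulting binary tree the nodes on a maximal left spine are the triangles
  of one fan, so that reading off the spine lengths in preorder gives the sizes of the fans in the
  order of the fan sequence, interspersed with zeros for the single edges.

  A filling is the word that records in which of the following parts of the shape each entry
  lies: X for the last column above the two long rows, Y and Z for the two long rows, W for the
  first column below them. Send X to 1, each Z and W to 0 and the \<open>j\<close>-th Y to \<open>e\<^sub>j + 2\<close>, where
  \<open>e\<^sub>j\<close> is the number of letters W between the \<open>j\<close>-th and the next Z. Since the letters Z and W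
  occur in the order \<open>Z W^e\<^sub>1 Z W^e\<^sub>2 \<dots>\<close>, the condition that the \<open>j\<close>-th Y precedes the \<open>j\<close>-th Z says
  exactly that the partial sums are nonnegative.
\<close>

section \<open>Lukasiewicz words and Dyck paths\<close>

text \<open>\<open>h\<close> is the partial sum reached so far. The guard \<open>0 < h + k\<close>
  keeps the next one nonnegative, which also makes the truncated subtraction exact.\<close>

fun lukasiewicz :: "nat \<Rightarrow> nat list \<Rightarrow> bool" where
  "lukasiewicz h [] \<longleftrightarrow> h = 0"
| "lukasiewicz h (k # ks) \<longleftrightarrow> 0 < h + k \<and> lukasiewicz (h + k - 1) ks"

text \<open>The last condition is meaningful only for \<open>l > 0\<close>, when the filtered list is not empty.\<close>

definition Luk :: "nat \<Rightarrow> nat \<Rightarrow> nat \<Rightarrow> nat list set" where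
  "Luk n l s = {ks. length ks = n \<and> lukasiewicz 0 ks \<and>
     length (filter (\<lambda>k. 2 \<le> k) ks) = l \<and> length (filter (\<lambda>k. k = 1) ks) = s \<and>
     last (filter (\<lambda>k. 0 < k) ks) \<noteq> 1}"

lemma lukasiewicz_sum: "lukasiewicz h ks \<Longrightarrow> h + sum_list ks = length ks"
  by (induction h ks rule: lukasiewicz.induct) auto

section \<open>Words as Dyck paths\<close>

definition path :: "nat list \<Rightarrow> step list" where
  "path ks = concat (map (\<lambda>k. replicate k U @ [D]) ks)"

lemma path_simps [simp]:
  "path [] = []"
  "path (k # ks) = replicate k U @ D # path ks"
  by (simp_all add: path_def)

lemma length_path: "length (path ks) = length ks + sum_list ks"
  by (induction ks) auto

text \<open>Both sides are cut at the first \<open>y\<close>. This decodes the ascents of a path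
  here and, after reversal, the blocks of a queue later on.\<close>

lemma replicate_append_Cons_cancel:
  assumes "x \<noteq> y"
  shows "replicate k x @ y # v = replicate k' x @ y # v' \<Longrightarrow> k = k' \<and> v = v'"
proof (induction k arbitrary: k')
  case 0
  then show ?case using assms by (cases k') auto
next
  case (Suc k)
  then show ?case using assms by (cases k') auto
qed

lemma inj_path: "inj path"
proof (rule injI)
  fix ks ks' :: "nat list"
  assume "path ks = path ks'"
  then show "ks = ks'"
  proof (induction ks arbitrary: ks')
    case Nil
    then show ?case by (cases ks') auto
  next
    case (Cons k ks)
    then show ?case by (cases ks') (auto dest: replicate_append_Cons_cancel[rotated])
  qed
qed

text \<open>Replaces the prefix counts of \<open>dyck_paths\<close> by a recursion on the current
  height, in step with the recursion of \<open>lukasiewicz\<close>.\<close>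

fun ballot :: "nat \<Rightarrow> step list \<Rightarrow> bool" where
  "ballot h [] \<longleftrightarrow> h = 0"
| "ballot h (U # w) \<longleftrightarrow> ballot (Suc h) w"
| "ballot h (D # w) \<longleftrightarrow> 0 < h \<and> ballot (h - 1) w"

lemma all_le_Suc: "(\<forall>k \<le> Suc n. P k) \<longleftrightarrow> P 0 \<and> (\<forall>k \<le> n. P (Suc k))"
  by (metis Suc_le_mono le0 not0_implies_Suc)

lemma ballot_iff:
  "ballot h w \<longleftrightarrow> count_list w D = h + count_list w U \<and>
     (\<forall>k \<le> length w. count_list (take k w) D \<le> h + count_list (take k w) U)"
proof (induction h w rule: ballot.induct)
  case (1 h)
  then show ?case by auto
next
  case (2 h w)
  then show ?case by (simp add: all_le_Suc)
next
  case (3 h w)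
  show ?case
  proof (cases h)
    case 0
    \<comment> \<open>A down step at height 0 is refuted by the prefix of length 1.\<close>
    have "\<exists>k \<le> length (D # w). \<not> count_list (take k (D # w)) D \<le> count_list (take k (D # w)) U"
      by (rule exI[of _ 1]) simp
    with 0 show ?thesis by (metis add_0 ballot.simps(3) less_irrefl)
  next
    case (Suc h')
    with 3 show ?thesis by (simp add: all_le_Suc)
  qed
qed

lemma length_eq_count_steps: "length w = count_list w U + count_list w D"
proof (induction w)
  case (Cons x w)
  then show ?case by (cases x) auto
qed simp

lemma dyck_paths_iff_ballot: "w \<in> dyck_paths n \<longleftrightarrow> ballot 0 w \<and> length w = 2 * n"
  using length_eq_count_steps[of w] by (auto simp: dyck_paths_def ballot_iff)

lemma ballot_replicate_U: "ballot h (replicate k U @ v) \<longleftrightarrow> ballot (h + k) v"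
  by (induction k arbitrary: h) auto

lemma ballot_path: "ballot h (path ks) \<longleftrightarrow> lukasiewicz h ks"
  by (induction ks arbitrary: h) (auto simp: ballot_replicate_U)

text \<open>A nonempty word ending at height 0 without going below it ends in \<open>D\<close>, so
  it breaks up into blocks of \<open>U\<close>s closed by a \<open>D\<close>. In the induction a
  \<open>U\<close> enlarges the first block of the rest, which exists because the height after
  \<open>U\<close> is positive.\<close>

lemma ballot_imp_path: "ballot h w \<Longrightarrow> \<exists>ks. w = path ks"
proof (induction h w rule: ballot.induct)
  case (1 h)
  then show ?case by (auto intro: exI[of _ "[]"])
next
  case (2 h w)
  then obtain ks where ks: "w = path ks" by auto
  with 2 obtain k ks' where "ks = k # ks'" by (cases ks) auto
  with ks have "U # w = path (Suc k # ks')" by simp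
  then show ?case ..
next
  case (3 h w)
  then obtain ks where "w = path ks" by auto
  then have "D # w = path (0 # ks)" by simp
  then show ?case ..
qed

lemma path_mem_dyck_paths_iff:
  "path ks \<in> dyck_paths n \<longleftrightarrow> lukasiewicz 0 ks \<and> length ks = n"
  using lukasiewicz_sum[of 0 ks]
  by (auto simp: dyck_paths_iff_ballot ballot_path length_path)

section \<open>Ascents of an encoded path\<close>

text \<open>The \<open>D\<close> at position \<open>k\<close> separates the initial run from the
  rest, so the ascents of \<open>w\<close> survive with their starts moved by \<open>Suc k\<close>.
  All statistics of \<open>path\<close> follow from this recursion.\<close>

lemma ascents_replicate_U_D:
  "ascents (replicate k U @ D # w) =
     (if k = 0 then {} else {(0, k)}) \<union> map_prod ((+) (Suc k)) id ` ascents w"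
  (is "ascents ?v = ?A \<union> ?f ` _")
proof -
  have low: "?v ! j = U" if "j < k" for j using that by (simp add: nth_append)
  have mid: "?v ! k = D" by (simp add: nth_append)
  have high: "?v ! (j + Suc k) = w ! j" for j by (simp add: nth_append)
  have len: "length ?v = length w + Suc k" by simp
  have shift: "(p + Suc k, l) \<in> ascents ?v \<longleftrightarrow> (p, l) \<in> ascents w" for p l
  proof -
    have 1: "(\<forall>j. p + Suc k \<le> j \<and> j < p + Suc k + l \<longrightarrow> ?v ! j = U) \<longleftrightarrow>
        (\<forall>j. p \<le> j \<and> j < p + l \<longrightarrow> w ! j = U)" (is "?L \<longleftrightarrow> ?R")
    proof
      assume ?L
      show ?R
      proof (intro allI impI)
        fix j assume "p \<le> j \<and> j < p + l"
        with \<open>?L\<close>[rule_format, of "j + Suc k"] show "w ! j = U" by (simp only: high) simp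
      qed
    next
      assume ?R
      show ?L
      proof (intro allI impI)
        fix j assume j: "p + Suc k \<le> j \<and> j < p + Suc k + l"
        then obtain j' where "j = j' + Suc k" by (metis add.commute add_leE le_Suc_ex)
        with \<open>?R\<close> j show "?v ! j = U" by (simp only: high) simp
      qed
    qed
    \<comment> \<open>An ascent at the very beginning of \<open>w\<close> now starts right after the
      separating \<open>D\<close>, so both alternatives on the right become the second one on the
      left.\<close>
    have 2: "(p + Suc k = 0 \<or> ?v ! (p + Suc k - 1) = D) \<longleftrightarrow> (p = 0 \<or> w ! (p - 1) = D)"
    proof (cases p)
      case 0
      then show ?thesis using mid by simp
    next
      case (Suc p')
      then have "p + Suc k - 1 = p' + Suc k" by simp
      then show ?thesis using Suc by (simp only: high) simp
    qed
    have 3: "(p + Suc k + l = length ?v \<or> ?v ! (p + Suc k + l) = D) \<longleftrightarrow>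
        (p + l = length w \<or> w ! (p + l) = D)"
    proof -
      have "p + Suc k + l = (p + l) + Suc k" by simp
      then show ?thesis by (simp only: high len) simp
    qed
    have 4: "p + Suc k + l \<le> length ?v \<longleftrightarrow> p + l \<le> length w" by simp
    show ?thesis by (simp only: ascents_def mem_Collect_eq prod.case 1 2 3 4)
  qed
  have zero: "(0, l) \<in> ascents ?v \<longleftrightarrow> k \<noteq> 0 \<and> l = k" for l
  proof
    assume l: "(0, l) \<in> ascents ?v"
    then have "1 \<le> l" "l \<le> length ?v" and U: "\<And>j. j < l \<Longrightarrow> ?v ! j = U"
      and D: "l = length ?v \<or> ?v ! l = D"
      by (auto simp: ascents_def)
    have "l \<le> k" using U[of k] mid by (metis not_le step.distinct(1))
    moreover have "\<not> l < k" using D low[of l] len by auto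
    ultimately show "k \<noteq> 0 \<and> l = k" using \<open>1 \<le> l\<close> by auto
  next
    assume "k \<noteq> 0 \<and> l = k"
    then show "(0, l) \<in> ascents ?v" using low mid by (auto simp: ascents_def)
  qed
  \<comment> \<open>A start at \<open>p\<close> needs a \<open>D\<close> at \<open>p - 1\<close>,
    which lies in the initial run of \<open>U\<close>s.\<close>
  have none: "(p, l) \<notin> ascents ?v" if "0 < p" "p \<le> k" for p l
  proof
    assume l: "(p, l) \<in> ascents ?v"
    then have "?v ! (p - 1) = D" using that by (auto simp only: ascents_def mem_Collect_eq prod.case)
    moreover have "p - 1 < k" using that by linarith
    ultimately show False using low[of "p - 1"] by simp
  qed
  show ?thesis
  proof (intro set_eqI)
    fix x :: "nat \<times> nat"
    obtain p l where x: "x = (p, l)" by (cases x)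
    consider "p = 0" | "0 < p" "p \<le> k" | p' where "p = p' + Suc k"
      by (metis add.commute gr0I le_Suc_ex not_less_eq_eq)
    then show "x \<in> ascents ?v \<longleftrightarrow> x \<in> ?A \<union> ?f ` ascents w"
    proof cases
      case 1
      then have "x \<notin> ?f ` ascents w" using x by auto
      then show ?thesis using x 1 zero[of l] by auto
    next
      case 2
      then have "x \<notin> ?A" "x \<notin> ?f ` ascents w" using x by auto
      then show ?thesis using x none[OF 2, of l] by simp
    next
      case 3
      then have x': "x = map_prod ((+) (Suc k)) id (p', l)" using x by simp
      have "inj (map_prod ((+) (Suc k)) (id :: nat \<Rightarrow> nat))" by (auto intro!: injI)
      then have "x \<in> ?f ` ascents w \<longleftrightarrow> (p', l) \<in> ascents w"
        unfolding x' by (rule inj_image_mem_iff)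
      moreover have "x \<notin> ?A" using x 3 by simp
      ultimately have "x \<in> ?A \<union> ?f ` ascents w \<longleftrightarrow> (p', l) \<in> ascents w" by blast
      then show ?thesis using x 3 shift[of p' l] by simp
    qed
  qed
qed

lemma ascents_Nil [simp]: "ascents [] = {}"
  by (auto simp: ascents_def)

lemma finite_ascents_path: "finite (ascents (path ks))"
  by (induction ks) (auto simp: ascents_replicate_U_D)

lemma long_ascents_path_Cons:
  "long_ascents (path (k # ks)) = (if 2 \<le> k then {(0, k)} else {}) \<union>
     map_prod ((+) (Suc k)) id ` long_ascents (path ks)"
  by (force simp: long_ascents_def ascents_replicate_U_D split: if_splits)

lemma singletons_path_Cons:
  "singletons (path (k # ks)) = (if k = 1 then {(0, k)} else {}) \<union>
     map_prod ((+) (Suc k)) id ` singletons (path ks)"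
  by (force simp: singletons_def ascents_replicate_U_D split: if_splits)

lemma inj_on_shift: "inj_on (map_prod ((+) (c :: nat)) id) A"
  by (auto intro!: inj_onI)

lemma card_long_ascents_path:
  "card (long_ascents (path ks)) = length (filter (\<lambda>k. 2 \<le> k) ks)"
proof (induction ks)
  case Nil
  then show ?case by (simp add: long_ascents_def)
next
  case (Cons k ks)
  have "finite (long_ascents (path ks))"
    using finite_ascents_path[of ks] by (auto simp: long_ascents_def intro: finite_subset[rotated])
  moreover have "(0, l) \<notin> map_prod ((+) (Suc k)) id ` long_ascents (path ks)" for l by auto
  ultimately show ?case
    using Cons by (auto simp: long_ascents_path_Cons card_image[OF inj_on_shift] simp del: path_simps)
qed

lemma card_singletons_path:
  "card (singletons (path ks)) = length (filter (\<lambda>k. k = 1) ks)"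
proof (induction ks)
  case Nil
  then show ?case by (simp add: singletons_def)
next
  case (Cons k ks)
  have "finite (singletons (path ks))"
    using finite_ascents_path[of ks] by (auto simp: singletons_def intro: finite_subset[rotated])
  moreover have "(0, l) \<notin> map_prod ((+) (Suc k)) id ` singletons (path ks)" for l by auto
  ultimately show ?case
    using Cons by (auto simp: singletons_path_Cons card_image[OF inj_on_shift] simp del: path_simps)
qed

lemma filter_ge_2_neq_Nil:
  "filter (\<lambda>k::nat. 2 \<le> k) ks \<noteq> [] \<Longrightarrow> filter (\<lambda>k. 0 < k) ks \<noteq> []"
  by (force simp: filter_empty_conv)

text \<open>Ascents come in the order of the nonzero letters, so a singleton behind all long ascents
  exists just when the last ascent is a singleton. In the induction only a leading letter 1 needs
  care.\<close>

lemma singleton_after_long_ascents_iff: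
  "(\<exists>(p, k) \<in> singletons (path ks). \<forall>(q, m) \<in> long_ascents (path ks). q < p) \<longleftrightarrow>
     filter (\<lambda>k. 0 < k) ks \<noteq> [] \<and> last (filter (\<lambda>k. 0 < k) ks) = 1"
proof (induction ks)
  case Nil
  then show ?case by (simp add: singletons_def)
next
  case (Cons k ks)
  let ?nz = "filter (\<lambda>k. 0 < k) ks"
  consider "k = 0" | "k = 1" | "2 \<le> k" by linarith
  then show ?case
  proof cases
    case 1
    then show ?thesis using Cons.IH
      by (auto simp: singletons_path_Cons long_ascents_path_Cons case_prod_beta simp del: path_simps)
  next
    case 2
    have fin: "finite (long_ascents (path ks))"
      using finite_ascents_path[of ks] by (auto simp: long_ascents_def intro: finite_subset[rotated])
    have "long_ascents (path ks) = {} \<longleftrightarrow> (\<forall>k \<in> set ks. \<not> 2 \<le> k)"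
      using card_long_ascents_path[of ks] fin
      by (metis card_0_eq filter_False filter_empty_conv length_0_conv)
    then have 1: "last ?nz = 1" if "?nz \<noteq> []" "long_ascents (path ks) = {}"
      using last_in_set[of ?nz] that by fastforce
    have 0: "long_ascents (path ks) = {}" if "?nz = []"
      using that filter_ge_2_neq_Nil[of ks] card_long_ascents_path[of ks] fin by fastforce
    \<comment> \<open>The new singleton starts at 0, before every long ascent of the rest, so it
      lies behind all of them only if there are none.\<close>
    have "(\<exists>(p, j) \<in> singletons (path (k # ks)). \<forall>(q, m) \<in> long_ascents (path (k # ks)). q < p)
        \<longleftrightarrow> long_ascents (path ks) = {} \<or>
          (\<exists>(p, k) \<in> singletons (path ks). \<forall>(q, m) \<in> long_ascents (path ks). q < p)"
      using 2 by (auto simp: singletons_path_Cons long_ascents_path_Cons case_prod_beta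
        simp del: path_simps)
    also have "\<dots> \<longleftrightarrow> ?nz = [] \<or> last ?nz = 1"
      using 0 1 unfolding Cons.IH by blast
    finally show ?thesis using 2 by simp
  next
    case 3
    then show ?thesis using Cons.IH
      by (auto simp: singletons_path_Cons long_ascents_path_Cons case_prod_beta simp del: path_simps)
  qed
qed

text \<open>\<open>0 < l\<close> provides a letter that is at least 2, so the list of nonzero
  letters is nonempty and its \<open>last\<close> is meaningful.\<close>

lemma Dyck_eq_image_path:
  assumes "0 < l"
  shows "Dyck n l s = path ` Luk n l s"
proof (intro set_eqI iffI)
  fix w assume w: "w \<in> Dyck n l s"
  then have "ballot 0 w" by (simp add: Dyck_def dyck_paths_iff_ballot)
  then obtain ks where ks: "w = path ks" using ballot_imp_path by blast
  with w assms filter_ge_2_neq_Nil[of ks] have "ks \<in> Luk n l s"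
    unfolding Dyck_def Luk_def mem_Collect_eq
    by (simp only: singleton_after_long_ascents_iff card_long_ascents_path card_singletons_path
      path_mem_dyck_paths_iff) auto
  with ks show "w \<in> path ` Luk n l s" by blast
next
  fix w assume "w \<in> path ` Luk n l s"
  then obtain ks where "w = path ks" "ks \<in> Luk n l s" by blast
  then show "w \<in> Dyck n l s"
    unfolding Dyck_def Luk_def mem_Collect_eq
    by (simp only: singleton_after_long_ascents_iff card_long_ascents_path card_singletons_path
      path_mem_dyck_paths_iff) simp
qed

lemma bij_betw_path:
  assumes "0 < l"
  shows "bij_betw path (Luk n l s) (Dyck n l s)"
  using inj_path Dyck_eq_image_path[OF assms] by (simp add: bij_betw_def inj_on_def)

section \<open>Triangulations of intervals\<close>

lemma doubleton_less_eq_iff: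
  fixes a b u v :: nat
  assumes "a < b" "u < v"
  shows "{a, b} = {u, v} \<longleftrightarrow> a = u \<and> b = v"
  using assms by (auto simp: doubleton_eq_iff)

lemma doubleton_mem_polygon_sides_iff:
  assumes "u < v"
  shows "{u, v} \<in> polygon_sides C \<longleftrightarrow>
    u \<in> C \<and> v \<in> C \<and> (C \<inter> {u<..<v} = {} \<or> C \<subseteq> {u..v})"
proof
  assume "{u, v} \<in> polygon_sides C"
  then obtain u' v' where uv: "{u, v} = {u', v'}" "u' < v'" "u' \<in> C" "v' \<in> C"
    "C \<inter> {u'<..<v'} = {} \<or> C \<subseteq> {u'..v'}"
    unfolding polygon_sides_def by blast
  then have "u = u'" "v = v'" using doubleton_less_eq_iff[OF assms uv(2)] by simp_all
  with uv show "u \<in> C \<and> v \<in> C \<and> (C \<inter> {u<..<v} = {} \<or> C \<subseteq> {u..v})" by simp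
next
  assume "u \<in> C \<and> v \<in> C \<and> (C \<inter> {u<..<v} = {} \<or> C \<subseteq> {u..v})"
  with assms show "{u, v} \<in> polygon_sides C" unfolding polygon_sides_def by blast
qed

lemma doubleton_mem_polygon_diagonals_iff:
  assumes "u < v"
  shows "{u, v} \<in> polygon_diagonals C \<longleftrightarrow>
    u \<in> C \<and> v \<in> C \<and> \<not> (C \<inter> {u<..<v} = {} \<or> C \<subseteq> {u..v})"
proof -
  have "{u, v} \<in> {{u, v} |u v. u \<in> C \<and> v \<in> C \<and> u < v} \<longleftrightarrow> u \<in> C \<and> v \<in> C"
    using assms by (auto simp: doubleton_eq_iff)
  then show ?thesis
    unfolding polygon_diagonals_def
    using doubleton_mem_polygon_sides_iff[OF assms, of C] by blast
qed

lemma polygon_sidesE: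
  assumes "e \<in> polygon_sides C"
  obtains u v where "e = {u, v}" "u < v" "u \<in> C" "v \<in> C"
  using assms unfolding polygon_sides_def by blast

lemma polygon_diagonalsE:
  assumes "e \<in> polygon_diagonals C"
  obtains u v where "e = {u, v}" "u < v" "u \<in> C" "v \<in> C"
  using assms unfolding polygon_diagonals_def by blast

text \<open>Two vertices of \<open>C\<close> span either a side or a diagonal of \<open>C\<close>,
  so the two conditions on \<open>T\<close> merge into one equivalence for each pair.\<close>

lemma mem_regions_iff:
  "C \<in> regions T \<longleftrightarrow> C \<subseteq> \<Union>T \<and> finite C \<and> 3 \<le> card C \<and>
     (\<forall>u \<in> C. \<forall>v \<in> C. u < v \<longrightarrow>
        ({u, v} \<in> T \<longleftrightarrow> C \<inter> {u<..<v} = {} \<or> C \<subseteq> {u..v}))"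
proof -
  define side where "side u v \<longleftrightarrow> C \<inter> {u<..<v} = {} \<or> C \<subseteq> {u..v}" for u v
  have sides: "polygon_sides C \<subseteq> T \<longleftrightarrow>
      (\<forall>u \<in> C. \<forall>v \<in> C. u < v \<longrightarrow> side u v \<longrightarrow> {u, v} \<in> T)"
    unfolding polygon_sides_def side_def[symmetric] by blast
  have diags: "polygon_diagonals C \<inter> T = {} \<longleftrightarrow>
      (\<forall>u \<in> C. \<forall>v \<in> C. u < v \<longrightarrow> {u, v} \<in> T \<longrightarrow> side u v)" (is "?L \<longleftrightarrow> ?R")
  proof
    assume ?L
    then show ?R using doubleton_mem_polygon_diagonals_iff[of _ _ C] unfolding side_def[symmetric] by blast
  next
    assume ?R
    show ?L
    proof (rule equals0I)
      fix e assume e: "e \<in> polygon_diagonals C \<inter> T"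
      then obtain u v where "e = {u, v}" "u < v" by (blast elim: polygon_diagonalsE)
      with e \<open>?R\<close> doubleton_mem_polygon_diagonals_iff[of u v C] show False
        unfolding side_def[symmetric] by blast
    qed
  qed
  have "polygon_sides C \<subseteq> T \<and> polygon_diagonals C \<inter> T = {} \<longleftrightarrow>
      (\<forall>u \<in> C. \<forall>v \<in> C. u < v \<longrightarrow> ({u, v} \<in> T \<longleftrightarrow> side u v))"
    unfolding sides diags by blast
  then show ?thesis unfolding regions_def mem_Collect_eq side_def by simp
qed

text \<open>A description by the edges themselves, which passes to the parts on either side of a
  cut. For \<open>m = Suc x\<close> it is the single edge, the base case of the recursion.\<close>

definition triangulated :: "nat \<Rightarrow> nat \<Rightarrow> nat set set \<Rightarrow> bool" where
  "triangulated x m T \<longleftrightarrow>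
     (\<forall>e \<in> T. \<exists>u v. e = {u, v} \<and> x \<le> u \<and> u < v \<and> v \<le> m) \<and>
     (\<forall>u. x \<le> u \<and> u < m \<longrightarrow> {u, Suc u} \<in> T) \<and> {x, m} \<in> T \<and>
     noncrossing T \<and> (\<forall>C \<in> regions T. card C = 3)"

lemma triangulatedD:
  assumes "triangulated x m T"
  shows "e \<in> T \<Longrightarrow> \<exists>u v. e = {u, v} \<and> x \<le> u \<and> u < v \<and> v \<le> m"
    and "u < v \<Longrightarrow> {u, v} \<in> T \<Longrightarrow> x \<le> u \<and> v \<le> m"
    and "x \<le> u \<Longrightarrow> u < m \<Longrightarrow> {u, Suc u} \<in> T"
    and "{x, m} \<in> T"
    and "a < b \<Longrightarrow> b < c \<Longrightarrow> c < d \<Longrightarrow> {a, c} \<in> T \<Longrightarrow> {b, d} \<in> T \<Longrightarrow> False"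
    and "C \<in> regions T \<Longrightarrow> card C = 3"
proof -
  show *: "e \<in> T \<Longrightarrow> \<exists>u v. e = {u, v} \<and> x \<le> u \<and> u < v \<and> v \<le> m" for e
    using assms unfolding triangulated_def by blast
  show "u < v \<Longrightarrow> {u, v} \<in> T \<Longrightarrow> x \<le> u \<and> v \<le> m"
    using *[of "{u, v}"] by (auto simp: doubleton_eq_iff)
  show "x \<le> u \<Longrightarrow> u < m \<Longrightarrow> {u, Suc u} \<in> T"
    using assms unfolding triangulated_def by blast
  show "{x, m} \<in> T"
    using assms unfolding triangulated_def by blast
  show "a < b \<Longrightarrow> b < c \<Longrightarrow> c < d \<Longrightarrow> {a, c} \<in> T \<Longrightarrow> {b, d} \<in> T \<Longrightarrow> False"
    using assms unfolding triangulated_def noncrossing_def by blast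
  show "C \<in> regions T \<Longrightarrow> card C = 3"
    using assms unfolding triangulated_def by blast
qed

lemma Union_triangulated:
  assumes "triangulated x m T" "x < m"
  shows "\<Union>T = {x..m}"
proof
  show "\<Union>T \<subseteq> {x..m}" using triangulatedD(1)[OF assms(1)] by fastforce
  show "{x..m} \<subseteq> \<Union>T"
  proof
    fix u assume "u \<in> {x..m}"
    then have "u = m \<or> x \<le> u \<and> u < m" by auto
    then show "u \<in> \<Union>T"
      using triangulatedD(3,4)[OF assms(1)] by blast
  qed
qed

lemma finite_triangulated:
  assumes "triangulated x m T" "x < m"
  shows "finite T"
  using Union_triangulated[OF assms] by (metis finite_UnionD finite_atLeastAtMost)

lemma polygon_sides_interval:
  assumes "x < m"
  shows "polygon_sides {x..m} = {{u, Suc u} |u. x \<le> u \<and> u < m} \<union> {{x, m}}"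
proof (intro equalityI subsetI)
  fix e assume e: "e \<in> polygon_sides {x..m}"
  then obtain u v where uv: "e = {u, v}" "u < v" by (blast elim: polygon_sidesE)
  then have "u \<in> {x..m}" "v \<in> {x..m}" "{x..m} \<inter> {u<..<v} = {} \<or> {x..m} \<subseteq> {u..v}"
    using e doubleton_mem_polygon_sides_iff by blast+
  moreover have "v = Suc u" if "{x..m} \<inter> {u<..<v} = {}"
  proof (rule ccontr)
    assume "v \<noteq> Suc u"
    with uv \<open>u \<in> {x..m}\<close> \<open>v \<in> {x..m}\<close> have "Suc u \<in> {x..m} \<inter> {u<..<v}" by auto
    with that show False by blast
  qed
  moreover have "u = x \<and> v = m" if "{x..m} \<subseteq> {u..v}"
    using that assms calculation(1,2) by auto
  ultimately show "e \<in> {{u, Suc u} |u. x \<le> u \<and> u < m} \<union> {{x, m}}"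
    using uv by auto
next
  fix e assume "e \<in> {{u, Suc u} |u. x \<le> u \<and> u < m} \<union> {{x, m}}"
  then consider u where "e = {u, Suc u}" "x \<le> u" "u < m" | "e = {x, m}" by blast
  then show "e \<in> polygon_sides {x..m}"
  proof cases
    case 1
    then show ?thesis by (simp add: doubleton_mem_polygon_sides_iff) auto
  next
    case 2
    then show ?thesis using assms by (simp add: doubleton_mem_polygon_sides_iff)
  qed
qed

text \<open>\<open>triangulations\<close> asks only the diagonals not to cross,
  \<open>triangulated\<close> all edges. The two agree because a side crosses nothing.\<close>

lemma mem_triangulations_interval_iff:
  assumes "x < m"
  shows "T \<in> triangulations {x..m} \<longleftrightarrow> triangulated x m T"
proof
  assume "T \<in> triangulations {x..m}"
  then obtain A where T: "T = polygon_sides {x..m} \<union> A" and A: "A \<subseteq> polygon_diagonals {x..m}"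
    and nc: "noncrossing A" and reg: "\<forall>C \<in> regions T. card C = 3"
    unfolding triangulations_def by blast
  have edge: "\<exists>u v. e = {u, v} \<and> x \<le> u \<and> u < v \<and> v \<le> m" if "e \<in> T" for e
  proof -
    from that T A have "e \<in> polygon_sides {x..m} \<or> e \<in> polygon_diagonals {x..m}" by blast
    then obtain u v where "e = {u, v}" "u < v" "u \<in> {x..m}" "v \<in> {x..m}"
      by (blast elim: polygon_sidesE polygon_diagonalsE)
    then show ?thesis by auto
  qed
  have bounds: "x \<le> u \<and> v \<le> m" if "u < v" "{u, v} \<in> T" for u v
    using edge[OF that(2)] that(1) by (auto simp: doubleton_eq_iff)
  have side: "v = Suc u \<or> u = x \<and> v = m" if "u < v" "{u, v} \<in> T" "{u, v} \<notin> A" for u v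
    using that assms unfolding T polygon_sides_interval[OF assms] by (auto simp: doubleton_eq_iff)
  have "noncrossing T"
    unfolding noncrossing_def
  proof (intro notI, elim exE conjE)
    fix a b c d assume abcd: "a < b" "b < c" "c < d" "{a, c} \<in> T" "{b, d} \<in> T"
    have "x \<le> a" "d \<le> m" using bounds[of a c] bounds[of b d] abcd by auto
    \<comment> \<open>Each of two crossing edges has labels of the polygon strictly between and
      strictly outside its ends, so it is no side and comes from \<open>A\<close>.\<close>
    then have "{a, c} \<in> A" "{b, d} \<in> A" using side[of a c] side[of b d] abcd by linarith+
    with nc abcd show False unfolding noncrossing_def by blast
  qed
  moreover have "{x, m} \<in> T" "\<forall>u. x \<le> u \<and> u < m \<longrightarrow> {u, Suc u} \<in> T"
    unfolding T polygon_sides_interval[OF assms] by blast+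
  ultimately show "triangulated x m T" using edge reg unfolding triangulated_def by blast
next
  assume T: "triangulated x m T"
  have sides: "polygon_sides {x..m} \<subseteq> T"
    unfolding polygon_sides_interval[OF assms] using triangulatedD(3,4)[OF T] by blast
  have "T - polygon_sides {x..m} \<subseteq> polygon_diagonals {x..m}"
  proof
    fix e assume e: "e \<in> T - polygon_sides {x..m}"
    then obtain u v where "e = {u, v}" "x \<le> u" "u < v" "v \<le> m" using triangulatedD(1)[OF T] by blast
    moreover from this have "u \<in> {x..m}" "v \<in> {x..m}" by auto
    ultimately show "e \<in> polygon_diagonals {x..m}"
      using e unfolding polygon_diagonals_def by blast
  qed
  moreover have "noncrossing (T - polygon_sides {x..m})"
    using T unfolding triangulated_def noncrossing_def by blast
  moreover have "T = polygon_sides {x..m} \<union> (T - polygon_sides {x..m})" using sides by blast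
  moreover have "\<forall>C \<in> regions T. card C = 3" using triangulatedD(6)[OF T] by blast
  ultimately show "T \<in> triangulations {x..m}"
    unfolding triangulations_def
    by (intro CollectI exI[of _ "T - polygon_sides {x..m}"]) simp
qed

text \<open>
  Among the polygons with sides in \<open>T\<close> that contain the side from \<open>x\<close> to \<open>m\<close>, one with the
  fewest vertices is a region, as a diagonal in \<open>T\<close> would cut off a smaller one.
\<close>

lemma region_at_side_exists:
  assumes side: "\<And>u. x \<le> u \<Longrightarrow> u < m \<Longrightarrow> {u, Suc u} \<in> T" and xm: "{x, m} \<in> T"
    and "x + 2 \<le> m"
  shows "\<exists>C \<in> regions T. C \<subseteq> {x..m} \<and> x \<in> C \<and> m \<in> C"
proof -
  define P where "P C \<longleftrightarrow> C \<subseteq> {x..m} \<and> x \<in> C \<and> m \<in> C \<and> 3 \<le> card C \<and>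
    (\<forall>u \<in> C. \<forall>v \<in> C. u < v \<longrightarrow> C \<inter> {u<..<v} = {} \<or> C \<subseteq> {u..v} \<longrightarrow> {u, v} \<in> T)" for C
  have "P {x..m}"
    unfolding P_def
  proof (intro conjI ballI impI)
    fix u v assume uv: "u \<in> {x..m}" "v \<in> {x..m}" "u < v" "{x..m} \<inter> {u<..<v} = {} \<or> {x..m} \<subseteq> {u..v}"
    then have "{u, v} \<in> polygon_sides {x..m}" using doubleton_mem_polygon_sides_iff by blast
    moreover have "x < m" using assms(3) by simp
    then have "polygon_sides {x..m} \<subseteq> T" unfolding polygon_sides_interval[OF \<open>x < m\<close>] using side xm by blast
    ultimately show "{u, v} \<in> T" by blast
  qed (use assms(3) in auto)
  then obtain C where C: "P C" and least: "\<And>C'. P C' \<Longrightarrow> card C \<le> card C'"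
    using ex_has_least_nat[of P _ card] by blast
  have sub: "C \<subseteq> {x..m}" "x \<in> C" "m \<in> C" "3 \<le> card C"
    and sides: "\<And>u v. u \<in> C \<Longrightarrow> v \<in> C \<Longrightarrow> u < v \<Longrightarrow> C \<inter> {u<..<v} = {} \<or> C \<subseteq> {u..v} \<Longrightarrow> {u, v} \<in> T"
    using C unfolding P_def by blast+
  have fin: "finite C" using sub(1) finite_subset by blast
  have "C \<inter> {u<..<v} = {} \<or> C \<subseteq> {u..v}" if uv: "u \<in> C" "v \<in> C" "u < v" "{u, v} \<in> T" for u v
  proof (rule ccontr)
    assume diag: "\<not> (C \<inter> {u<..<v} = {} \<or> C \<subseteq> {u..v})"
    \<comment> \<open>The diagonal \<open>{u, v}\<close> cuts off the removed vertices. What is kept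
      includes a vertex outside \<open>{u..v}\<close>, hence at least three.\<close>
    let ?C = "C - {u<..<v}"
    have "card ?C < card C" using diag fin by (intro psubset_card_mono) auto
    moreover have "P ?C"
      unfolding P_def
    proof (intro conjI ballI impI)
      show "?C \<subseteq> {x..m}" "x \<in> ?C" "m \<in> ?C" using sub uv by auto
      from diag obtain z where z: "z \<in> C" "z \<notin> {u..v}" by blast
      then have "card {u, v, z} = 3" using uv(3) by auto
      moreover have "{u, v, z} \<subseteq> ?C" using z uv by auto
      ultimately show "3 \<le> card ?C" using card_mono[of ?C "{u, v, z}"] fin by simp
    next
      fix p q assume pq: "p \<in> ?C" "q \<in> ?C" "p < q" "?C \<inter> {p<..<q} = {} \<or> ?C \<subseteq> {p..q}"
      show "{p, q} \<in> T"
      proof (cases "?C \<subseteq> {p..q}")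
        case True
        then have "u \<in> {p..q}" "v \<in> {p..q}" using uv by auto
        then have "C \<subseteq> {p..q}" using True by (force simp: subset_iff)
        then show ?thesis using sides pq by blast
      next
        case False
        then have gap: "?C \<inter> {p<..<q} = {}" using pq(4) by blast
        show ?thesis
        proof (cases "C \<inter> {p<..<q} = {}")
          case True
          then show ?thesis using sides pq by blast
        next
          case False
          \<comment> \<open>A removed vertex \<open>w\<close> between \<open>p\<close> and
            \<open>q\<close> forces \<open>{p, q}\<close> to be the cut \<open>{u, v}\<close>
            itself, since neither pair has an end strictly inside the other.\<close>
          then obtain w where w: "w \<in> C" "p < w" "w < q" by auto
          then have "u < w" "w < v" using gap by auto
          have "u \<notin> {p<..<q}" "v \<notin> {p<..<q}" using gap uv by auto
          moreover have "p \<notin> {u<..<v}" "q \<notin> {u<..<v}" using pq by auto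
          ultimately have "p = u" "q = v" using w \<open>u < w\<close> \<open>w < v\<close> by auto
          then show ?thesis using uv by simp
        qed
      qed
    qed
    ultimately show False using least[of ?C] by simp
  qed
  moreover have "C \<subseteq> \<Union>T"
  proof
    fix u assume "u \<in> C"
    then have "u = m \<or> x \<le> u \<and> u < m" using sub(1) by auto
    then show "u \<in> \<Union>T" using side xm by blast
  qed
  ultimately have "C \<in> regions T" using sub(4) fin sides unfolding mem_regions_iff by blast
  then show ?thesis using sub by blast
qed

section \<open>Cutting at the triangle on the outer side\<close>

lemma card_3_between:
  fixes x m :: nat
  assumes "card C = 3" "x \<in> C" "m \<in> C" "C \<subseteq> {x..m}" "x < m"
  obtains y where "C = {x, y, m}" "x < y" "y < m"
proof -
  have "finite C" using assms(1) card.infinite by fastforce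
  then have "card (C - {x, m}) = 1" using assms by (simp add: card_Diff_subset)
  then obtain y where y: "C - {x, m} = {y}" by (meson card_1_singletonE)
  then have "C = {x, y, m}" using assms by blast
  moreover have "y \<in> {x..m}" "y \<noteq> x" "y \<noteq> m" using y assms(4) by blast+
  ultimately show thesis using that[of y] by auto
qed

text \<open>On vertices in \<open>{p..q}\<close> the two edge sets agree, so a region of the
  restriction is a region of \<open>T\<close>.\<close>

lemma triangulated_restrict:
  assumes T: "triangulated x m T" and "{p, q} \<in> T" "p < q"
  shows "triangulated p q {e \<in> T. e \<subseteq> {p..q}}" (is "triangulated p q ?T")
proof -
  have xpqm: "x \<le> p" "q \<le> m" using triangulatedD(2)[OF T assms(3,2)] by auto
  have mem: "{u, v} \<in> ?T \<longleftrightarrow> {u, v} \<in> T \<and> u \<in> {p..q} \<and> v \<in> {p..q}" for u v by auto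
  have "card C = 3" if C: "C \<in> regions ?T" for C
  proof -
    have "C \<subseteq> {p..q}" using C unfolding mem_regions_iff by blast
    then have "{u, v} \<in> ?T \<longleftrightarrow> {u, v} \<in> T" if "u \<in> C" "v \<in> C" for u v
      using that mem by blast
    moreover have "C \<subseteq> \<Union>T" using C unfolding mem_regions_iff by blast
    ultimately have "C \<in> regions T" using C unfolding mem_regions_iff by simp
    then show ?thesis by (rule triangulatedD(6)[OF T])
  qed
  moreover have "\<exists>u v. e = {u, v} \<and> p \<le> u \<and> u < v \<and> v \<le> q" if e: "e \<in> ?T" for e
  proof -
    obtain u v where "e = {u, v}" "u < v" using triangulatedD(1)[OF T, of e] e by blast
    then show ?thesis using e by auto
  qed
  moreover have "{u, Suc u} \<in> ?T" if "p \<le> u" "u < q" for u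
    unfolding mem using triangulatedD(3)[OF T, of u] that xpqm by simp
  moreover have "{p, q} \<in> ?T" using assms by auto
  moreover have "noncrossing ?T" using T unfolding triangulated_def noncrossing_def by blast
  ultimately show ?thesis unfolding triangulated_def by blast
qed

text \<open>The region on the side \<open>{x, m}\<close> is a triangle, and \<open>y\<close> is its
  third vertex. No edge other than \<open>{x, m}\<close> passes over \<open>y\<close>, since it
  would cross \<open>{x, y}\<close> or \<open>{y, m}\<close>.\<close>

lemma triangulated_split:
  assumes T: "triangulated x m T" and "x + 2 \<le> m"
  obtains y T1 T2 where "x < y" "y < m" "triangulated x y T1" "triangulated y m T2"
    "T = insert {x, m} (T1 \<union> T2)"
proof -
  obtain C where C: "C \<in> regions T" "C \<subseteq> {x..m}" "x \<in> C" "m \<in> C"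
    using region_at_side_exists[of x m T] triangulatedD[OF T] assms(2) by blast
  moreover have "card C = 3" using triangulatedD(6)[OF T C(1)] .
  ultimately obtain y where y: "C = {x, y, m}" "x < y" "y < m"
    using card_3_between[of C x m] assms(2) by (metis add_2_eq_Suc' not_less_eq_eq Suc_leD not_le)
  have "C \<inter> {x<..<y} = {}" "C \<inter> {y<..<m} = {}" using y by auto
  then have xy: "{x, y} \<in> T" and ym: "{y, m} \<in> T"
    using C(1) y unfolding mem_regions_iff by auto
  let ?T1 = "{e \<in> T. e \<subseteq> {x..y}}" and ?T2 = "{e \<in> T. e \<subseteq> {y..m}}"
  have "T = insert {x, m} (?T1 \<union> ?T2)"
  proof (intro equalityI subsetI)
    fix e assume e: "e \<in> T"
    then obtain u v where uv: "e = {u, v}" "x \<le> u" "u < v" "v \<le> m"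
      using triangulatedD(1)[OF T] by blast
    consider "v \<le> y" | "y \<le> u" | "u < y" "y < v" by linarith
    then show "e \<in> insert {x, m} (?T1 \<union> ?T2)"
    proof cases
      case 3
      \<comment> \<open>If \<open>x < u\<close>, the edge crosses \<open>{x, y}\<close>; if
        \<open>v < m\<close>, it crosses \<open>{y, m}\<close>.\<close>
      have "u = x" using triangulatedD(5)[OF T, of x u y v] uv 3 xy e by (cases "x < u") auto
      moreover have "v = m" using triangulatedD(5)[OF T, of u y v m] uv 3 ym e by (cases "v < m") auto
      ultimately show ?thesis using uv by simp
    qed (use e uv in auto)
  next
    fix e assume "e \<in> insert {x, m} (?T1 \<union> ?T2)"
    then show "e \<in> T" using triangulatedD(4)[OF T] by blast
  qed
  then show thesis using that y triangulated_restrict[OF T xy] triangulated_restrict[OF T ym] by blast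
qed

section \<open>Gluing two triangulations onto a triangle\<close>

locale triangulation_glue =
  fixes x y m :: nat and T1 T2 :: "nat set set"
  assumes xy: "x < y" and ym: "y < m"
    and T1: "triangulated x y T1" and T2: "triangulated y m T2"
begin

definition T :: "nat set set" where
  "T = insert {x, m} (T1 \<union> T2)"

lemma doubleton_mem_iff:
  assumes "u < v"
  shows "{u, v} \<in> T \<longleftrightarrow> u = x \<and> v = m \<or> {u, v} \<in> T1 \<or> {u, v} \<in> T2"
proof -
  have "x < m" using xy ym by simp
  then show ?thesis unfolding T_def by (simp add: doubleton_less_eq_iff[OF assms])
qed

lemma bounds1: "u < v \<Longrightarrow> {u, v} \<in> T1 \<Longrightarrow> x \<le> u \<and> v \<le> y"
  using triangulatedD(2)[OF T1] .

lemma bounds2: "u < v \<Longrightarrow> {u, v} \<in> T2 \<Longrightarrow> y \<le> u \<and> v \<le> m"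
  using triangulatedD(2)[OF T2] .

text \<open>Edges of \<open>T1\<close> end at or before \<open>y\<close> and those of
  \<open>T2\<close> start at or after it, so only the closing edge can pass over
  \<open>y\<close>.\<close>

lemma straddling_edge:
  assumes "u < y" "y < v" "{u, v} \<in> T"
  shows "u = x \<and> v = m"
proof -
  have "u < v" using assms by simp
  with assms doubleton_mem_iff[of u v] bounds1[of u v] bounds2[of u v] show ?thesis by auto
qed

lemma bounds: "u < v \<Longrightarrow> {u, v} \<in> T \<Longrightarrow> x \<le> u \<and> v \<le> m"
  using doubleton_mem_iff[of u v] bounds1[of u v] bounds2[of u v] xy ym by auto

lemma mem_left: "u < v \<Longrightarrow> v \<le> y \<Longrightarrow> {u, v} \<in> T \<longleftrightarrow> {u, v} \<in> T1"
  using doubleton_mem_iff[of u v] bounds2[of u v] ym by auto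

lemma mem_right: "u < v \<Longrightarrow> y \<le> u \<Longrightarrow> {u, v} \<in> T \<longleftrightarrow> {u, v} \<in> T2"
  using doubleton_mem_iff[of u v] bounds1[of u v] xy by auto

lemma T_edge: "e \<in> T \<Longrightarrow> \<exists>u v. e = {u, v} \<and> x \<le> u \<and> u < v \<and> v \<le> m"
proof -
  assume "e \<in> T"
  then consider "e = {x, m}" | "e \<in> T1" | "e \<in> T2" unfolding T_def by blast
  then show ?thesis
  proof cases
    case 1
    then show ?thesis using xy ym by (intro exI[of _ x] exI[of _ m]) simp
  next
    case 2
    then show ?thesis using triangulatedD(1)[OF T1, of e] ym by (meson less_imp_le order_trans)
  next
    case 3
    then show ?thesis using triangulatedD(1)[OF T2, of e] xy by (meson less_imp_le order_trans)
  qed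
qed

lemma T_side: "x \<le> u \<Longrightarrow> u < m \<Longrightarrow> {u, Suc u} \<in> T"
  using triangulatedD(3)[OF T1, of u] triangulatedD(3)[OF T2, of u]
  unfolding T_def by (cases "u < y") auto

lemma Union_T: "\<Union>T = {x..m}"
  using Union_triangulated[OF T1 xy] Union_triangulated[OF T2 ym] xy ym
  unfolding T_def by auto

lemma noncrossing_T: "noncrossing T"
  unfolding noncrossing_def
proof (intro notI, elim exE conjE)
  fix a b c d assume abcd: "a < b" "b < c" "c < d" "{a, c} \<in> T" "{b, d} \<in> T"
  have ac: "a < c" and bd: "b < d" using abcd by auto
  have lim: "x \<le> a" "d \<le> m" using bounds[OF ac] bounds[OF bd] abcd by auto
  consider "d \<le> y" | "y \<le> a" | "a < y" "y < d" by linarith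
  then show False
  proof cases
    case 1
    then show False using triangulatedD(5)[OF T1 abcd(1-3)] abcd mem_left[OF ac] mem_left[OF bd] by simp
  next
    case 2
    then show False using triangulatedD(5)[OF T2 abcd(1-3)] abcd mem_right[OF ac] mem_right[OF bd] by simp
  next
    case 3
    \<comment> \<open>An edge from \<open>a\<close> past \<open>y\<close> would be
      \<open>{x, m}\<close>, leaving no room for \<open>d\<close>. Hence \<open>{b, d}\<close>
      passes over \<open>y\<close>, yet \<open>b\<close> is not \<open>x\<close>.\<close>
    have "c \<le> y" using straddling_edge[of a c] 3 abcd lim by (metis leD not_le_imp_less)
    then have "b < y" using abcd by simp
    then show False using straddling_edge[of b d] 3 abcd lim by simp
  qed
qed

text \<open>A region on one side of \<open>y\<close> belongs to \<open>T1\<close> or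
  \<open>T2\<close>. One with vertices on both sides is constrained by the fact that
  \<open>{x, m}\<close> is the only edge over \<open>y\<close>, which leaves just the triangle
  \<open>{x, y, m}\<close>.\<close>

lemma regions_T: "regions T = insert {x, y, m} (regions T1 \<union> regions T2)"
proof (intro equalityI subsetI)
  fix C assume C: "C \<in> regions T"
  have fin: "finite C" and card: "3 \<le> card C" and sub: "C \<subseteq> {x..m}"
    and edge: "\<And>u v. u \<in> C \<Longrightarrow> v \<in> C \<Longrightarrow> u < v \<Longrightarrow>
      {u, v} \<in> T \<longleftrightarrow> C \<inter> {u<..<v} = {} \<or> C \<subseteq> {u..v}"
    using C Union_T unfolding mem_regions_iff by auto
  consider "C \<subseteq> {x..y}" | "C \<subseteq> {y..m}" | p q where "p \<in> C" "p < y" "q \<in> C" "y < q"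
    using sub by (meson atLeastAtMost_iff not_le subset_iff)
  then show "C \<in> insert {x, y, m} (regions T1 \<union> regions T2)"
  proof cases
    case 1
    then have "{u, v} \<in> T \<longleftrightarrow> {u, v} \<in> T1" if "u \<in> C" "v \<in> C" "u < v" for u v
      using that mem_left by auto
    then have "C \<in> regions T1"
      using 1 fin card edge Union_triangulated[OF T1 xy] unfolding mem_regions_iff by simp
    then show ?thesis by blast
  next
    case 2
    then have "{u, v} \<in> T \<longleftrightarrow> {u, v} \<in> T2" if "u \<in> C" "v \<in> C" "u < v" for u v
      using that mem_right by auto
    then have "C \<in> regions T2"
      using 2 fin card edge Union_triangulated[OF T2 ym] unfolding mem_regions_iff by simp
    then show ?thesis by blast
  next
    case 3
    have "C \<noteq> {}" using 3 by blast
    then have minmax: "Min C \<in> C" "Max C \<in> C" "C \<subseteq> {Min C..Max C}" using fin by auto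
    have "Min C < y" "y < Max C" using Min_le[OF fin 3(1)] Max_ge[OF fin 3(3)] 3 by auto
    \<comment> \<open>The smallest and the largest vertex are joined by the closing side of the
      region.\<close>
    moreover from this have "{Min C, Max C} \<in> T" using edge minmax by auto
    ultimately have ends: "Min C = x" "Max C = m" using straddling_edge by blast+
    then have xm: "x \<in> C" "m \<in> C" using minmax by auto
    have "y \<in> C"
    proof (rule ccontr)
      assume y: "y \<notin> C"
      \<comment> \<open>Without \<open>y\<close>, the vertices of \<open>C\<close> next to it on
        either side would be joined by a side over \<open>y\<close>, hence be \<open>x\<close> and
        \<open>m\<close>, leaving \<open>C\<close> only two vertices.\<close>
      let ?p = "Max (C \<inter> {..<y})" and ?q = "Min (C \<inter> {y<..})"
      have p: "?p \<in> C \<inter> {..<y}" using fin 3 by (intro Max_in) auto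
      have q: "?q \<in> C \<inter> {y<..}" using fin 3 by (intro Min_in) auto
      have "C \<inter> {?p<..<?q} = {}"
      proof (rule equals0I)
        fix r assume r: "r \<in> C \<inter> {?p<..<?q}"
        then have "r < y \<or> y < r" using y by (metis IntD1 nat_neq_iff)
        then show False
        proof
          assume "r < y"
          then have "r \<le> ?p" using r fin by (intro Max_ge) auto
          then show False using r by simp
        next
          assume "y < r"
          then have "?q \<le> r" using r fin by (intro Min_le) auto
          then show False using r by simp
        qed
      qed
      moreover have "?p < ?q" "?p < y" "y < ?q" using p q by auto
      ultimately have "{?p, ?q} \<in> T" using edge[of ?p ?q] p q by blast
      then have "?p = x" "?q = m" using straddling_edge \<open>?p < y\<close> \<open>y < ?q\<close> by blast+
      then have "C \<subseteq> {x, m}" using \<open>C \<inter> {?p<..<?q} = {}\<close> sub by fastforce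
      then have "card C \<le> card {x, m}" by (intro card_mono) auto
      also have "\<dots> \<le> 2" by (simp add: card_insert_if)
      finally show False using card by simp
    qed
    have "{x, y} \<in> T" "{y, m} \<in> T"
      using triangulatedD(4)[OF T1] triangulatedD(4)[OF T2] unfolding T_def by auto
    \<comment> \<open>An edge of \<open>T\<close> between two vertices of a region is a side of the
      region.\<close>
    then have "C \<inter> {x<..<y} = {} \<or> C \<subseteq> {x..y}" "C \<inter> {y<..<m} = {} \<or> C \<subseteq> {y..m}"
      using edge[of x y] edge[of y m] xm \<open>y \<in> C\<close> xy ym by blast+
    moreover have "\<not> C \<subseteq> {x..y}" "\<not> C \<subseteq> {y..m}" using xm xy ym by auto
    ultimately have "C \<inter> {x<..<y} = {}" "C \<inter> {y<..<m} = {}" by blast+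
    then have "C = {x, y, m}" using sub xm \<open>y \<in> C\<close> by fastforce
    then show ?thesis by blast
  qed
next
  fix C assume "C \<in> insert {x, y, m} (regions T1 \<union> regions T2)"
  then consider "C = {x, y, m}" | "C \<in> regions T1" | "C \<in> regions T2" by blast
  then show "C \<in> regions T"
  proof cases
    case 1
    have "{x, y} \<in> T" "{y, m} \<in> T" "{x, m} \<in> T"
      using triangulatedD(4)[OF T1] triangulatedD(4)[OF T2] unfolding T_def by auto
    then show ?thesis using 1 xy ym Union_T unfolding mem_regions_iff by auto
  next
    case 2
    then have "C \<subseteq> {x..y}" using Union_triangulated[OF T1 xy] unfolding mem_regions_iff by simp
    then have "{u, v} \<in> T \<longleftrightarrow> {u, v} \<in> T1" if "u \<in> C" "v \<in> C" "u < v" for u v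
      using that mem_left by auto
    moreover have "C \<subseteq> \<Union>T" using 2 unfolding mem_regions_iff T_def by blast
    ultimately show ?thesis using 2 unfolding mem_regions_iff by simp
  next
    case 3
    then have "C \<subseteq> {y..m}" using Union_triangulated[OF T2 ym] unfolding mem_regions_iff by simp
    then have "{u, v} \<in> T \<longleftrightarrow> {u, v} \<in> T2" if "u \<in> C" "v \<in> C" "u < v" for u v
      using that mem_right by auto
    moreover have "C \<subseteq> \<Union>T" using 3 unfolding mem_regions_iff T_def by blast
    ultimately show ?thesis using 3 unfolding mem_regions_iff by simp
  qed
qed

lemma triangulated_T: "triangulated x m T"
proof -
  have "card C = 3" if "C \<in> regions T" for C
    using that triangulatedD(6)[OF T1] triangulatedD(6)[OF T2] xy ym unfolding regions_T by auto
  then show ?thesis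
    using T_edge T_side noncrossing_T unfolding triangulated_def by (auto simp: T_def)
qed

text \<open>Cutting undoes gluing. This serves to read off the subpolygons at \<open>x\<close> and
  to recover the left subtree from a triangulation.\<close>

lemma restrict_left: "{e \<in> T. e \<subseteq> {x..y}} = T1"
proof (intro equalityI subsetI)
  fix e assume e: "e \<in> {e \<in> T. e \<subseteq> {x..y}}"
  then obtain u v where "e = {u, v}" "u < v" using T_edge by blast
  then show "e \<in> T1" using e mem_left by auto
next
  fix e assume "e \<in> T1"
  then show "e \<in> {e \<in> T. e \<subseteq> {x..y}}"
    using Union_triangulated[OF T1 xy] unfolding T_def by blast
qed

lemma restrict_right: "{e \<in> T. e \<subseteq> {y..m}} = T2"
proof (intro equalityI subsetI)
  fix e assume e: "e \<in> {e \<in> T. e \<subseteq> {y..m}}"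
  then obtain u v where "e = {u, v}" "u < v" using T_edge by blast
  then show "e \<in> T2" using e mem_right by auto
next
  fix e assume "e \<in> T2"
  then show "e \<in> {e \<in> T. e \<subseteq> {y..m}}"
    using Union_triangulated[OF T2 ym] unfolding T_def by blast
qed

end

section \<open>Binary trees and fan sequences\<close>

datatype bintree = Leaf | Node bintree bintree

text \<open>\<open>size\<close> counts the nodes, which become the triangles, and each leaf becomes
  a side \<open>{u, Suc u}\<close>. A tree with \<open>n\<close> nodes thus occupies the
  \<open>n + 2\<close> labels from \<open>x\<close> on.\<close>

fun tree_triangulation :: "bintree \<Rightarrow> nat \<Rightarrow> nat set set" where
  "tree_triangulation Leaf x = {{x, Suc x}}"
| "tree_triangulation (Node l r) x = insert {x, x + size (Node l r) + 1}
     (tree_triangulation l x \<union> tree_triangulation r (x + size l + 1))"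

text \<open>The first argument counts the nodes above the tree on its left spine.\<close>

fun tree_word :: "nat \<Rightarrow> bintree \<Rightarrow> nat list" where
  "tree_word c Leaf = [c]"
| "tree_word c (Node l r) = tree_word (Suc c) l @ tree_word 0 r"

section \<open>Triangulations as binary trees\<close>

lemma regions_edge: "regions {{x, Suc x}} = {}"
proof (rule equals0I)
  fix C assume "C \<in> regions {{x, Suc x}}"
  then have "C \<subseteq> {x, Suc x}" "3 \<le> card C" unfolding mem_regions_iff by auto
  moreover from this have "card C \<le> card {x, Suc x}" by (intro card_mono) auto
  ultimately show False by simp
qed

lemma triangulated_edge_iff: "triangulated x (Suc x) T \<longleftrightarrow> T = {{x, Suc x}}"
proof
  assume T: "triangulated x (Suc x) T"
  have "e = {x, Suc x}" if "e \<in> T" for e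
  proof -
    obtain u v where uv: "e = {u, v}" "x \<le> u" "u < v" "v \<le> Suc x"
      using triangulatedD(1)[OF T \<open>e \<in> T\<close>] by blast
    then have "u = x" "v = Suc x" by auto
    with uv show ?thesis by simp
  qed
  then show "T = {{x, Suc x}}" using triangulatedD(4)[OF T] by blast
next
  assume T: "T = {{x, Suc x}}"
  have "noncrossing T"
    unfolding noncrossing_def T by (auto simp: doubleton_eq_iff)
  moreover have "\<exists>u v. {x, Suc x} = {u, v} \<and> x \<le> u \<and> u < v \<and> v \<le> Suc x"
    by (intro exI[of _ x] exI[of _ "Suc x"]) simp
  moreover have "u = x" if "x \<le> u \<and> u < Suc x" for u using that by simp
  ultimately show "triangulated x (Suc x) T"
    unfolding triangulated_def T regions_edge by blast
qed

lemma triangulated_tree_triangulation: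
  "triangulated x (x + size t + 1) (tree_triangulation t x)"
proof (induction t arbitrary: x)
  case Leaf
  then show ?case using triangulated_edge_iff by simp
next
  case (Node l r)
  let ?y = "x + size l + 1" and ?m = "x + size (Node l r) + 1"
  interpret triangulation_glue x ?y ?m "tree_triangulation l x" "tree_triangulation r ?y"
    using Node.IH(1)[of x] Node.IH(2)[of ?y] by (simp add: triangulation_glue_def add.assoc)
  show ?case using triangulated_T unfolding T_def by simp
qed

lemma tree_triangulation_glue:
  "triangulation_glue x (x + size l + 1) (x + size (Node l r) + 1)
     (tree_triangulation l x) (tree_triangulation r (x + size l + 1))"
  using triangulated_tree_triangulation[of x l]
    triangulated_tree_triangulation[of "x + size l + 1" r]
  by (simp add: triangulation_glue_def add.assoc)

text \<open>The tree is built by cutting repeatedly at the triangle on the outer side, which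
  shortens the interval.\<close>

lemma triangulated_imp_tree_triangulation:
  "triangulated x m T \<Longrightarrow> x < m \<Longrightarrow> \<exists>t. m = x + size t + 1 \<and> T = tree_triangulation t x"
proof (induction "m - x" arbitrary: x m T rule: less_induct)
  case less
  show ?case
  proof (cases "m = Suc x")
    case True
    then show ?thesis using less.prems triangulated_edge_iff by (intro exI[of _ Leaf]) auto
  next
    case False
    then obtain y T1 T2 where y: "x < y" "y < m" "triangulated x y T1" "triangulated y m T2"
      "T = insert {x, m} (T1 \<union> T2)"
      using triangulated_split[OF less.prems(1)] less.prems(2) by (metis Suc_leI add_2_eq_Suc' le_neq_implies_less)
    have "y - x < m - x" "m - y < m - x" using y by auto
    then obtain l r where "y = x + size l + 1" "T1 = tree_triangulation l x"
      "m = y + size r + 1" "T2 = tree_triangulation r y"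
      using less.hyps y by metis
    then show ?thesis using y by (intro exI[of _ "Node l r"]) (simp add: add.assoc)
  qed
qed

text \<open>Equal sizes give a common outer side. The apex of the triangle on it is determined by
  the triangulation, and with it the two restrictions that encode the subtrees.\<close>

lemma tree_triangulation_inj:
  "tree_triangulation t x = tree_triangulation t' x \<Longrightarrow> size t = size t' \<Longrightarrow> t = t'"
proof (induction t arbitrary: t' x)
  case Leaf
  then show ?case by (cases t') auto
next
  case (Node l r)
  then obtain l' r' where t': "t' = Node l' r'" by (cases t') auto
  let ?m = "x + size (Node l r) + 1" and ?y = "x + size l + 1" and ?y' = "x + size l' + 1"
  have m: "?m = x + size (Node l' r') + 1" using Node.prems t' by simp
  interpret g: triangulation_glue x ?y ?m "tree_triangulation l x" "tree_triangulation r ?y"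
    by (rule tree_triangulation_glue)
  interpret g': triangulation_glue x ?y' ?m "tree_triangulation l' x" "tree_triangulation r' ?y'"
    unfolding m by (rule tree_triangulation_glue)
  have "g.T = tree_triangulation (Node l r) x" unfolding g.T_def by simp
  moreover have "g'.T = tree_triangulation t' x"
    unfolding g'.T_def by (simp only: t' m tree_triangulation.simps)
  ultimately have T: "g.T = g'.T" using Node.prems(1) by simp
  have edges: "{x, ?y} \<in> g.T" "{?y, ?m} \<in> g.T" "{x, ?y'} \<in> g'.T" "{?y', ?m} \<in> g'.T"
    using triangulatedD(4)[OF g.T1] triangulatedD(4)[OF g.T2]
      triangulatedD(4)[OF g'.T1] triangulatedD(4)[OF g'.T2]
    unfolding g.T_def g'.T_def by blast+
  \<comment> \<open>For two different apexes, the edge from \<open>x\<close> to the larger one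
    crosses the edge from the smaller one to \<open>?m\<close>.\<close>
  have "\<not> ?y < ?y'"
    using triangulatedD(5)[OF g.triangulated_T, of x ?y ?y' ?m] edges T g.xy g'.ym by auto
  moreover have "\<not> ?y' < ?y"
    using triangulatedD(5)[OF g.triangulated_T, of x ?y' ?y ?m] edges T g'.xy g.ym by auto
  ultimately have sl: "size l = size l'" by simp
  then have sr: "size r = size r'" using m by simp
  have "tree_triangulation l x = tree_triangulation l' x"
    using g.restrict_left g'.restrict_left T sl by simp
  then have "l = l'" using Node.IH(1) sl by blast
  have "tree_triangulation r ?y = tree_triangulation r' ?y"
    using g.restrict_right g'.restrict_right T sl by simp
  then have "r = r'" using Node.IH(2) sr by blast
  with \<open>l = l'\<close> t' show ?case by simp
qed

section \<open>Fan sequences of glued triangulations\<close>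

lemma triangulated_neighbour:
  assumes "triangulated x m T" "{x, z} \<in> T"
  shows "x < z \<and> z \<le> m"
  using triangulatedD(1)[OF assms] by (auto simp: doubleton_eq_iff)

lemma sorted_list_of_set_insert_greatest:
  fixes z :: nat
  assumes "finite A" "\<And>a. a \<in> A \<Longrightarrow> a < z"
  shows "sorted_list_of_set (insert z A) = sorted_list_of_set A @ [z]"
proof -
  have "sorted (sorted_list_of_set A @ [z])" "distinct (sorted_list_of_set A @ [z])"
    using assms by (auto simp: sorted_append dest: less_imp_le)
  moreover have "set (sorted_list_of_set A @ [z]) = insert z A" using assms by simp
  ultimately show ?thesis
    by (metis sorted_list_of_set.idem_if_sorted_distinct)
qed

lemma zip_tl_snoc:
  "vs \<noteq> [] \<Longrightarrow> zip (vs @ [z]) (tl (vs @ [z])) = zip vs (tl vs) @ [(last vs, z)]"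
proof (induction vs)
  case (Cons v vs)
  then show ?case by (cases vs) auto
qed simp

context triangulation_glue
begin

text \<open>The neighbours of \<open>x\<close> are those in \<open>T1\<close>, of which
  \<open>y\<close> is the largest, followed by \<open>m\<close>. The only new pair of consecutive
  neighbours is \<open>(y, m)\<close>, and it bounds \<open>T2\<close>.\<close>

lemma subpolygons_T: "subpolygons x T = subpolygons x T1 @ [T2]"
proof -
  let ?N = "\<lambda>S. {z. {x, z} \<in> S}" and ?P = "\<lambda>S (u, v). {e \<in> delete_vertex x S. e \<subseteq> {u..v}}"
  let ?vs = "sorted_list_of_set (?N T1)"
  have N1: "x < z \<and> z \<le> y" if "{x, z} \<in> T1" for z
    using triangulated_neighbour[OF T1 that] .
  have "?N T1 \<subseteq> {..y}" using N1 by auto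
  then have fin: "finite (?N T1)" using finite_subset by blast
  have "x < m" using xy ym by simp
  have "{x, z} \<notin> T2" for z
  proof
    assume "{x, z} \<in> T2"
    then have "x \<in> {y..m}" using Union_triangulated[OF T2 ym] by blast
    then show False using xy by simp
  qed
  then have "?N T = insert m (?N T1)"
    using \<open>x < m\<close> unfolding T_def by (auto simp: doubleton_eq_iff)
  moreover have "z < m" if "z \<in> ?N T1" for z using that N1 ym by fastforce
  ultimately have vs: "sorted_list_of_set (?N T) = ?vs @ [m]"
    using sorted_list_of_set_insert_greatest[OF fin, of m] by simp
  have y: "y \<in> ?N T1" using triangulatedD(4)[OF T1] by simp
  then have "?N T1 = insert y (?N T1 - {y})" by blast
  moreover have "z < y" if "z \<in> ?N T1 - {y}" for z using that N1 by fastforce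
  ultimately have last: "?vs = sorted_list_of_set (?N T1 - {y}) @ [y]"
    using sorted_list_of_set_insert_greatest[of "?N T1 - {y}" y] fin by (metis finite_Diff)
  have "?vs \<noteq> []" "last ?vs = y" unfolding last by simp_all
  then have zip: "zip (?vs @ [m]) (tl (?vs @ [m])) = zip ?vs (tl ?vs) @ [(y, m)]"
    using zip_tl_snoc[of ?vs m] by (simp only: not_False_eq_True)
  have "?P T (u, v) = ?P T1 (u, v)" if "(u, v) \<in> set (zip ?vs (tl ?vs))" for u v
  proof -
    have "u \<in> set ?vs" "v \<in> set (tl ?vs)" using that by (auto dest: set_zip_leftD set_zip_rightD)
    then have "u \<in> set ?vs" "v \<in> set ?vs" using list.set_sel(2)[OF \<open>?vs \<noteq> []\<close>] by blast+
    then have "u \<in> ?N T1" "v \<in> ?N T1" using fin by simp_all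
    then have "x \<le> u" "v \<le> y" using N1 by (auto simp: less_imp_le)
    then have "{u..v} \<subseteq> {x..y}" by auto
    then show ?thesis using restrict_left unfolding delete_vertex_def by blast
  qed
  then have "map (?P T) (zip ?vs (tl ?vs)) = map (?P T1) (zip ?vs (tl ?vs))" by auto
  moreover have "?P T (y, m) = T2"
  proof -
    have "x \<notin> {y..m}" using xy by simp
    then show ?thesis using restrict_right unfolding delete_vertex_def by blast
  qed
  ultimately show ?thesis unfolding subpolygons_def Let_def vs zip by simp
qed

text \<open>The label \<open>x\<close> does not occur in \<open>T2\<close>, so the closing triangle
  is all that joins the fan.\<close>

lemma fan_T: "fan T x = insert {x, y, m} (fan T1 x)"
proof -
  have "x \<notin> C" if "C \<in> regions T2" for C
    using that Union_triangulated[OF T2 ym] xy unfolding mem_regions_iff by auto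
  then show ?thesis unfolding fan_def regions_T by blast
qed

lemma card_fan_T: "card (fan T x) = Suc (card (fan T1 x))"
proof -
  have sub: "C \<subseteq> {x..y}" if "C \<in> fan T1 x" for C
    using that Union_triangulated[OF T1 xy] unfolding fan_def mem_regions_iff by auto
  then have "fan T1 x \<subseteq> Pow {x..y}" by blast
  then have "finite (fan T1 x)" using finite_subset by blast
  moreover have "{x, y, m} \<notin> fan T1 x" using sub[of "{x, y, m}"] ym by auto
  ultimately show ?thesis unfolding fan_T by simp
qed

lemma fan_sequence_T:
  "fan_sequence T = fan T x # concat (map fan_sequence (subpolygons x T1)) @ fan_sequence T2"
proof -
  have "x < m" using xy ym by simp
  have "finite T" using finite_triangulated[OF triangulated_T \<open>x < m\<close>] .
  \<comment> \<open>Two distinct edges suffice for \<open>fan_sequence\<close> to take its recursive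
    branch.\<close>
  moreover have "{{x, m}, {x, y}} \<subseteq> T" using triangulatedD(4)[OF T1] unfolding T_def by blast
  moreover have "{x, m} \<noteq> {x, y}" using ym by (auto simp: doubleton_eq_iff)
  ultimately have "1 < card T" using card_mono[of T "{{x, m}, {x, y}}"] by simp
  moreover have "Min (\<Union>T) = x" unfolding Union_T using \<open>x < m\<close> by (intro Min_eqI) auto
  ultimately show ?thesis
    by (subst fan_sequence.simps) (simp add: Union_T subpolygons_T)
qed

end

text \<open>The first part follows a left spine: \<open>c\<close> triangles of the current fan lie
  above \<open>t\<close>. Its premise excludes \<open>c = 0\<close> at a leaf, where the word
  \<open>[0]\<close> contributes no fan. The second part supplies the fan sequences of the right
  subtrees.\<close>

lemma tree_triangulation_fans:
  "(0 < c \<or> t \<noteq> Leaf \<longrightarrow>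
     (c + card (fan (tree_triangulation t x) x)) #
       map card (concat (map fan_sequence (subpolygons x (tree_triangulation t x)))) =
     filter (\<lambda>k. 0 < k) (tree_word c t)) \<and>
   map card (fan_sequence (tree_triangulation t x)) = filter (\<lambda>k. 0 < k) (tree_word 0 t)"
proof (induction t arbitrary: c x)
  case Leaf
  have "{z. {x, z} = {x, Suc x}} = {Suc x}" by (auto simp: doubleton_eq_iff)
  then have "subpolygons x {{x, Suc x}} = []"
    unfolding subpolygons_def by simp
  moreover have "fan {{x, Suc x}} x = {}" unfolding fan_def regions_edge by simp
  moreover have "fan_sequence {{x, Suc x}} = []" by (subst fan_sequence.simps) simp
  ultimately show ?case by simp
next
  case (Node l r)
  let ?y = "x + size l + 1"
  interpret triangulation_glue x ?y "x + size (Node l r) + 1"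
    "tree_triangulation l x" "tree_triangulation r ?y"
    by (rule tree_triangulation_glue)
  have T: "tree_triangulation (Node l r) x = T" unfolding T_def by simp
  \<comment> \<open>Passing to the left child moves one triangle of the fan into the
    counter.\<close>
  have IH: "(Suc c + card (fan (tree_triangulation l x) x)) #
       map card (concat (map fan_sequence (subpolygons x (tree_triangulation l x)))) =
     filter (\<lambda>k. 0 < k) (tree_word (Suc c) l)" for c
    using Node.IH(1)[of "Suc c" x] by blast
  have fan: "(c + card (fan T x)) # map card (concat (map fan_sequence (subpolygons x T))) =
     filter (\<lambda>k. 0 < k) (tree_word c (Node l r))" for c
    using IH[of c] Node.IH(2)[of 0 ?y]
    unfolding card_fan_T subpolygons_T tree_word.simps filter_append by (simp flip: append_Cons)
  have "map card (fan_sequence T) =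
      (0 + card (fan T x)) # map card (concat (map fan_sequence (subpolygons x T)))"
    unfolding fan_sequence_T subpolygons_T by simp
  then show ?case unfolding T using fan[of c] fan[of 0] by (simp only: simp_thms)
qed

section \<open>Words of binary trees\<close>

lemma length_tree_word: "length (tree_word c t) = size t + 1"
  by (induction t arbitrary: c) auto

lemma tree_word_neq_Nil [simp]: "tree_word c t \<noteq> []"
  using length_tree_word[of c t] by auto

text \<open>The last leaf is the root or is reached by a step to the right, in both cases with
  counter 0. This final letter carries no information and is removed by
  \<open>butlast\<close>.\<close>

lemma last_tree_word: "last (tree_word 0 t) = 0"
proof -
  have "last (tree_word c t) = (if t = Leaf then c else 0)" for c
    by (induction t arbitrary: c) auto
  then show ?thesis by simp
qed

lemma tree_word_eq_snoc: "tree_word 0 t = butlast (tree_word 0 t) @ [0]"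
  using append_butlast_last_id[of "tree_word 0 t"] last_tree_word[of t] by simp

text \<open>For the height condition a whole subtree acts like the single letter \<open>c\<close>: a
  node adds one to the counter on its left, and its right subtree takes one back.\<close>

lemma lukasiewicz_tree_word_append:
  "lukasiewicz h (tree_word c t @ v) \<longleftrightarrow> 0 < h + c \<and> lukasiewicz (h + c - 1) v"
  by (induction t arbitrary: c h v) auto

lemma lukasiewicz_butlast_tree_word: "lukasiewicz h (butlast (tree_word 0 t)) \<longleftrightarrow> h = 0"
  by (induction t arbitrary: h) (auto simp: butlast_append lukasiewicz_tree_word_append)

lemma hd_tree_word_ge: "c \<le> hd (tree_word c t)"
proof (induction t arbitrary: c)
  case (Node l r)
  show ?case using Node.IH(1)[of "Suc c"] by (simp add: Suc_leD)
qed simp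

text \<open>Tree words form a prefix code. The first letter tells a leaf from a node: it is
  \<open>c\<close> for a leaf and at least \<open>Suc c\<close> for a node.\<close>

lemma tree_word_append_cancel:
  "tree_word c t @ v = tree_word c t' @ v' \<Longrightarrow> t = t' \<and> v = v'"
proof (induction t arbitrary: c t' v v')
  case Leaf
  show ?case
  proof (cases t')
    case Leaf
    with Leaf.prems show ?thesis by simp
  next
    case (Node l' r')
    have "hd (tree_word c t' @ v') = c" using Leaf.prems by (metis append_Cons list.sel(1) tree_word.simps(1))
    then show ?thesis using hd_tree_word_ge[of "Suc c" l'] Node by simp
  qed
next
  case (Node l r)
  show ?case
  proof (cases t')
    case Leaf
    have "hd (tree_word c (Node l r) @ v) = c" using Node.prems Leaf by simp
    then show ?thesis using hd_tree_word_ge[of "Suc c" l] by simp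
  next
    case (Node l' r')
    with Node.prems have "tree_word (Suc c) l @ (tree_word 0 r @ v) =
      tree_word (Suc c) l' @ (tree_word 0 r' @ v')" by simp
    then have "l = l'" "tree_word 0 r @ v = tree_word 0 r' @ v'" using Node.IH(1) by blast+
    moreover from this(2) have "r = r' \<and> v = v'" using Node.IH(2) by blast
    ultimately show ?thesis using Node by simp
  qed
qed

text \<open>\<open>us\<close> lists the right subtrees along a left spine from bottom to top, so a
  further one is attached at a new root.\<close>

lemma tree_word_spine_exists: "\<exists>t. \<forall>c. tree_word c t = (c + length us) # concat (map (tree_word 0) us)"
proof (induction us rule: rev_induct)
  case Nil
  show ?case by (rule exI[of _ Leaf]) simp
next
  case (snoc u us)
  then obtain t where "\<forall>c. tree_word c t = (c + length us) # concat (map (tree_word 0) us)" by blast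
  then show ?case by (intro exI[of _ "Node t u"]) simp
qed

text \<open>The word is decoded from the right, starting with the leaf for the final 0. A letter
  \<open>k\<close> replaces the first \<open>k\<close> of the \<open>h + k\<close> trees found so
  far by one tree with these as the right subtrees of its spine.\<close>

lemma lukasiewicz_imp_tree_words:
  "lukasiewicz h ks \<Longrightarrow> \<exists>ts. length ts = h + 1 \<and> ks @ [0] = concat (map (tree_word 0) ts)"
proof (induction ks arbitrary: h)
  case Nil
  then show ?case by (intro exI[of _ "[Leaf]"]) simp
next
  case (Cons k ks)
  then obtain ts where ts: "length ts = h + k" "ks @ [0] = concat (map (tree_word 0) ts)"
    by fastforce
  obtain t where t: "tree_word 0 t = k # concat (map (tree_word 0) (take k ts))"
    using tree_word_spine_exists[of "take k ts"] ts(1) by (metis add_0 length_take min.absorb2 le_add2)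
  have "concat (map (tree_word 0) (t # drop k ts)) =
      k # concat (map (tree_word 0) (take k ts @ drop k ts))"
    unfolding map_append concat_append using t by simp
  then have "(k # ks) @ [0] = concat (map (tree_word 0) (t # drop k ts))" using ts(2) by simp
  moreover have "length (t # drop k ts) = h + 1" using ts(1) by simp
  ultimately show ?case by blast
qed

lemma length_filter_positive:
  "length (filter (\<lambda>k::nat. 0 < k) ks) =
     length (filter (\<lambda>k. 2 \<le> k) ks) + length (filter (\<lambda>k. k = 1) ks)"
  by (induction ks) auto

lemma bij_betw_tree_word_Luk:
  "bij_betw (\<lambda>t. butlast (tree_word 0 t)) {t. size t = n \<and> butlast (tree_word 0 t) \<in> Luk n l s}
     (Luk n l s)"
proof (rule bij_betw_imageI)
  show "inj_on (\<lambda>t. butlast (tree_word 0 t)) {t. size t = n \<and> butlast (tree_word 0 t) \<in> Luk n l s}"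
    by (rule inj_onI) (metis append_Nil2 tree_word_append_cancel tree_word_eq_snoc)
  have "\<exists>t. size t = n \<and> butlast (tree_word 0 t) = ks" if "ks \<in> Luk n l s" for ks
  proof -
    have ks: "length ks = n" "lukasiewicz 0 ks" using that by (auto simp: Luk_def)
    obtain ts where ts: "length ts = 0 + 1" "ks @ [0] = concat (map (tree_word 0) ts)"
      using lukasiewicz_imp_tree_words[OF ks(2)] by blast
    \<comment> \<open>Starting height 0 leaves exactly one tree.\<close>
    then obtain t where "ts = [t]" by (auto simp: length_Suc_conv)
    with ts have t: "tree_word 0 t = ks @ [0]" by simp
    then have "size t = n" using length_tree_word[of 0 t] ks by simp
    with t show ?thesis by auto
  qed
  then show "(\<lambda>t. butlast (tree_word 0 t)) ` {t. size t = n \<and> butlast (tree_word 0 t) \<in> Luk n l s} =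
      Luk n l s"
    by auto
qed

text \<open>The fan sizes are the nonzero letters, so singular fans are letters 1 and the others are
  letters at least 2. \<open>0 < l\<close> makes the fan sequence nonempty, which
  \<open>last\<close> requires.\<close>

lemma tree_triangulation_mem_Tri_iff:
  assumes "0 < l" "size t = n"
  shows "tree_triangulation t 1 \<in> Tri (n + 2) l s \<longleftrightarrow> butlast (tree_word 0 t) \<in> Luk n l s"
proof -
  let ?fs = "fan_sequence (tree_triangulation t 1)" and ?ks = "butlast (tree_word 0 t)"
  have "triangulated 1 (n + 2) (tree_triangulation t 1)"
    using triangulated_tree_triangulation[of 1 t] assms(2) by simp
  then have tri: "tree_triangulation t 1 \<in> triangulations {1..n + 2}"
    using mem_triangulations_interval_iff[of 1 "n + 2"] by simp
  have "map card ?fs = filter (\<lambda>k. 0 < k) (tree_word 0 t)"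
    using tree_triangulation_fans by blast
  also have "\<dots> = filter (\<lambda>k. 0 < k) ?ks" by (subst tree_word_eq_snoc) simp
  finally have fs: "map card ?fs = filter (\<lambda>k. 0 < k) ?ks" .
  have len: "length ?fs = length (filter (\<lambda>k. 2 \<le> k) ?ks) + length (filter (\<lambda>k. k = 1) ?ks)"
    using arg_cong[OF fs, of length] by (simp only: length_map length_filter_positive)
  have "filter (\<lambda>k. k = 1) (map card ?fs) = filter (\<lambda>k. k = 1) ?ks"
    unfolding fs by (auto intro: filter_cong)
  then have sing: "length (filter singular ?fs) = length (filter (\<lambda>k. k = 1) ?ks)"
    unfolding singular_def by (metis (no_types, lifting) comp_def filter_cong filter_map length_map)
  have last: "singular (last ?fs) \<longleftrightarrow> last (filter (\<lambda>k. 0 < k) ?ks) = 1" if "?fs \<noteq> []"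
    using that fs unfolding singular_def by (metis last_map)
  have "length ?ks = n" using length_tree_word[of 0 t] assms(2) by simp
  moreover have "lukasiewicz 0 ?ks" by (simp add: lukasiewicz_butlast_tree_word)
  ultimately have Luk: "?ks \<in> Luk n l s \<longleftrightarrow> (length (filter (\<lambda>k. 2 \<le> k) ?ks) = l \<and>
      length (filter (\<lambda>k. k = 1) ?ks) = s) \<and> last (filter (\<lambda>k. 0 < k) ?ks) \<noteq> 1"
    by (simp add: Luk_def)
  have Tri: "tree_triangulation t 1 \<in> Tri (n + 2) l s \<longleftrightarrow> (length ?fs = s + l \<and>
      length (filter singular ?fs) = s) \<and> \<not> singular (last ?fs)"
    using tri by (simp add: Tri_def)
  \<comment> \<open>\<open>Tri\<close> fixes the number of all fans, \<open>Luk\<close> that of the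
    nonsingular ones; given the number of singular fans these agree.\<close>
  have "length ?fs = s + l \<and> length (filter singular ?fs) = s \<longleftrightarrow>
      length (filter (\<lambda>k. 2 \<le> k) ?ks) = l \<and> length (filter (\<lambda>k. k = 1) ?ks) = s"
    unfolding len sing by linarith
  moreover have "?fs \<noteq> []" if "length ?fs = s + l" using that assms(1) by auto
  ultimately show ?thesis unfolding Luk Tri using last by blast
qed

lemma bij_betw_tree_triangulation_Tri:
  assumes "0 < l"
  shows "bij_betw (\<lambda>t. tree_triangulation t 1)
    {t. size t = n \<and> butlast (tree_word 0 t) \<in> Luk n l s} (Tri (n + 2) l s)"
proof (rule bij_betw_imageI)
  show "inj_on (\<lambda>t. tree_triangulation t 1) {t. size t = n \<and> butlast (tree_word 0 t) \<in> Luk n l s}"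
    using tree_triangulation_inj by (intro inj_onI) auto
  show "(\<lambda>t. tree_triangulation t 1) ` {t. size t = n \<and> butlast (tree_word 0 t) \<in> Luk n l s} =
      Tri (n + 2) l s"
  proof (intro equalityI subsetI)
    fix T assume "T \<in> (\<lambda>t. tree_triangulation t 1) `
      {t. size t = n \<and> butlast (tree_word 0 t) \<in> Luk n l s}"
    then show "T \<in> Tri (n + 2) l s" using tree_triangulation_mem_Tri_iff[OF assms] by blast
  next
    fix T assume T: "T \<in> Tri (n + 2) l s"
    then have "triangulated 1 (n + 2) T"
      using mem_triangulations_interval_iff[of 1 "n + 2"] by (simp add: Tri_def)
    then obtain t where "n + 2 = 1 + size t + 1" and t: "T = tree_triangulation t 1"
      using triangulated_imp_tree_triangulation[of 1 "n + 2" T] by auto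
    then have "size t = n" by simp
    with T t tree_triangulation_mem_Tri_iff[OF assms, of t n s]
    show "T \<in> (\<lambda>t. tree_triangulation t 1) `
      {t. size t = n \<and> butlast (tree_word 0 t) \<in> Luk n l s}" by blast
  qed
qed

lemma bij_betw_Luk_Tri:
  assumes "0 < l"
  shows "\<exists>f. bij_betw f (Luk n l s) (Tri (n + 2) l s)"
  using bij_betw_trans[OF bij_betw_inv_into[OF bij_betw_tree_word_Luk]
      bij_betw_tree_triangulation_Tri[OF assms]] by blast

section \<open>Words of skew fillings\<close>

datatype letter = X | Y | Z | W

text \<open>The second argument is a first-in first-out queue of the letters Z and W yet to be written.\<close>

inductive queue_run :: "nat list \<Rightarrow> letter list \<Rightarrow> letter list \<Rightarrow> bool" where
  Nil: "queue_run [] [] []"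
| X: "queue_run ks q w \<Longrightarrow> queue_run (1 # ks) q (X # w)"
| Y: "queue_run ks (q @ Z # replicate e W) w \<Longrightarrow> queue_run ((e + 2) # ks) q (Y # w)"
| pop: "queue_run ks q w \<Longrightarrow> c = Z \<or> c = W \<Longrightarrow> queue_run (0 # ks) (c # q) (c # w)"

text \<open>The last three conditions express the column comparisons between different parts of the
  shape: \<open>Y\<close> above \<open>Z\<close>, the first \<open>Z\<close> above every
  \<open>W\<close>, every \<open>X\<close> above the last \<open>Y\<close>. Both filtered lists are
  nonempty, since \<open>Y\<close> and \<open>Z\<close> occur.\<close>

definition skew_words :: "nat \<Rightarrow> nat \<Rightarrow> nat \<Rightarrow> letter list set" where
  "skew_words a i b = {w.
     count_list w X = b - 2 \<and> count_list w Y = i + 1 \<and>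
     count_list w Z = i + 1 \<and> count_list w W = a - 2 \<and>
     (\<forall>k. count_list (take k w) Z \<le> count_list (take k w) Y) \<and>
     hd (filter (\<lambda>c. c = Z \<or> c = W) w) = Z \<and>
     last (filter (\<lambda>c. c = X \<or> c = Y) w) = Y}"

section \<open>Runs of the queue\<close>

lemma length_eq_count_letters:
  "length w = count_list w X + count_list w Y + count_list w Z + count_list w W"
proof (induction w)
  case (Cons c w)
  then show ?case by (cases c) auto
qed simp

lemma queue_run_length: "queue_run ks q w \<Longrightarrow> length w = length ks"
  by (induction rule: queue_run.induct) auto

text \<open>The height is the length of the queue: \<open>X\<close> keeps it, \<open>Y\<close> adds
  \<open>e + 1\<close>, and a letter taken from the queue lowers it by one.\<close>

lemma queue_run_lukasiewicz: "queue_run ks q w \<Longrightarrow> lukasiewicz (length q) ks"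
  by (induction rule: queue_run.induct) auto

lemma queue_run_set: "queue_run ks q w \<Longrightarrow> set q \<subseteq> {Z, W}"
  by (induction rule: queue_run.induct) auto

lemma queue_run_count_X:
  "queue_run ks q w \<Longrightarrow> count_list w X = length (filter (\<lambda>k. k = 1) ks)"
  by (induction rule: queue_run.induct) auto

lemma queue_run_count_Y:
  "queue_run ks q w \<Longrightarrow> count_list w Y = length (filter (\<lambda>k. 2 \<le> k) ks)"
  by (induction rule: queue_run.induct) auto

lemma count_list_replicate_neq: "c \<noteq> d \<Longrightarrow> count_list (replicate e d) c = 0"
  by (induction e) auto

text \<open>Each \<open>Y\<close> enqueues exactly one \<open>Z\<close>, and a run ends with the
  empty queue, so every queued \<open>Z\<close> gets written.\<close>

lemma queue_run_count_Z:
  "queue_run ks q w \<Longrightarrow> count_list w Z = count_list q Z + count_list w Y"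
  by (induction rule: queue_run.induct) (auto simp: count_list_replicate_neq)

lemma queue_run_count_prefix:
  "queue_run ks q w \<Longrightarrow> count_list (take k w) Z \<le> count_list q Z + count_list (take k w) Y"
proof (induction arbitrary: k rule: queue_run.induct)
  case Nil
  then show ?case by simp
next
  case (X ks q w)
  then show ?case by (cases k) auto
next
  case (Y ks q e w)
  show ?case
  proof (cases k)
    case (Suc k')
    with Y.IH[of k'] show ?thesis by (simp add: count_list_replicate_neq)
  qed simp
next
  case (pop ks q w c)
  show ?case
  proof (cases k)
    case (Suc k')
    with pop.IH[of k'] show ?thesis using pop.hyps by auto
  qed simp
qed

lemma queue_run_filter_XY:
  "queue_run ks q w \<Longrightarrow> filter (\<lambda>c. c = X \<or> c = Y) w =
     map (\<lambda>k. if k = 1 then X else Y) (filter (\<lambda>k. 0 < k) ks)"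
  by (induction rule: queue_run.induct) auto

text \<open>The contents of \<open>q\<close> are written before anything enqueued later, and the
  first block enqueued later begins with \<open>Z\<close>.\<close>

lemma queue_run_filter_ZW:
  "queue_run ks q w \<Longrightarrow> \<exists>r. filter (\<lambda>c. c = Z \<or> c = W) w = q @ r \<and> (r = [] \<or> hd r = Z)"
proof (induction rule: queue_run.induct)
  case (Y ks q e w)
  then show ?case by auto
next
  case (pop ks q w c)
  then obtain r where "filter (\<lambda>c. c = Z \<or> c = W) w = q @ r" "r = [] \<or> hd r = Z" by blast
  with pop.hyps show ?case by (intro exI[of _ r]) auto
next
  case (X ks q w)
  then obtain r where "filter (\<lambda>c. c = Z \<or> c = W) w = q @ r" "r = [] \<or> hd r = Z" by blast
  then show ?case by (intro exI[of _ r]) simp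
qed simp

text \<open>The run cannot get stuck: the Lukasiewicz condition makes the queue nonempty whenever
  the letter 0 is read.\<close>

lemma queue_run_word_exists:
  "lukasiewicz (length q) ks \<Longrightarrow> set q \<subseteq> {Z, W} \<Longrightarrow> \<exists>w. queue_run ks q w"
proof (induction ks arbitrary: q)
  case Nil
  then show ?case by (auto intro: queue_run.Nil)
next
  case (Cons k ks)
  consider "k = 0" | "k = 1" | e where "k = e + 2"
    by (metis One_nat_def add_2_eq_Suc' not0_implies_Suc)
  then show ?case
  proof cases
    case 1
    with Cons.prems obtain c q' where q: "q = c # q'" by (cases q) auto
    with Cons 1 obtain w where "queue_run ks q' w" by fastforce
    then have "queue_run (0 # ks) (c # q') (c # w)"
      by (rule queue_run.pop) (use q Cons.prems in auto)
    with 1 q show ?thesis by blast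
  next
    case 2
    with Cons obtain w where "queue_run ks q w" by fastforce
    with 2 show ?thesis by (blast intro: queue_run.X)
  next
    case 3
    have "\<exists>w. queue_run ks (q @ Z # replicate e W) w"
      by (rule Cons.IH) (use Cons.prems 3 in \<open>auto simp: add.commute\<close>)
    with 3 show ?thesis by (blast intro: queue_run.Y)
  qed
qed

lemma queue_run_word_unique: "queue_run ks q w \<Longrightarrow> queue_run ks q w' \<Longrightarrow> w = w'"
proof (induction arbitrary: w' rule: queue_run.induct)
  case Nil
  then show ?case by cases auto
next
  case (X ks q w)
  from X.prems X.IH show ?case by cases auto
next
  case (Y ks q e w)
  from Y.prems Y.IH show ?case by cases auto
next
  case (pop ks q w c)
  from pop.prems pop.IH show ?case by cases auto
qed

text \<open>The cut is at the last \<open>Z\<close> of the queue, which reversal turns into the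
  first.\<close>

lemma append_block_cancel:
  assumes "q @ Z # replicate e W = q' @ Z # replicate e' W"
  shows "q = q' \<and> e = e'"
proof -
  have "replicate e W @ Z # rev q = replicate e' W @ Z # rev q'"
    using arg_cong[OF assms, of rev] by simp
  then show ?thesis using replicate_append_Cons_cancel[of W Z e "rev q" e' "rev q'"] by simp
qed

text \<open>Reading \<open>w\<close> backwards from the empty final queue reconstructs every earlier
  queue; at a \<open>Y\<close> the enqueued block is the part from the last \<open>Z\<close>
  on.\<close>

lemma queue_run_path_unique:
  "queue_run ks q w \<Longrightarrow> queue_run ks' q' w \<Longrightarrow> ks = ks' \<and> q = q'"
proof (induction arbitrary: ks' q' rule: queue_run.induct)
  case Nil
  then show ?case by cases auto
next
  case (X ks q w)
  from X.prems X.IH show ?case by cases auto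
next
  case (Y ks q e w)
  from Y.prems show ?case
  proof cases
    case (Y ks'' e')
    with \<open>\<And>ks' q'. queue_run ks' q' w \<Longrightarrow> _\<close> have "ks = ks''"
      "q @ Z # replicate e W = q' @ Z # replicate e' W" by blast+
    with Y append_block_cancel show ?thesis by blast
  qed auto
next
  case (pop ks q w c)
  from pop.prems pop.IH pop.hyps show ?case by cases auto
qed

text \<open>Read backwards, a \<open>Y\<close> must remove a block of one \<open>Z\<close> and some
  \<open>W\<close> from the end of the queue. The condition on suffixes ensures that a
  \<open>Z\<close> is there.\<close>

lemma queue_run_path_exists:
  "(\<And>k. count_list (drop k w) Y \<le> count_list (drop k w) Z) \<Longrightarrow> \<exists>ks q. queue_run ks q w"
proof (induction w)
  case Nil
  then show ?case by (blast intro: queue_run.Nil)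
next
  case (Cons c w)
  have "count_list (drop k w) Y \<le> count_list (drop k w) Z" for k
    using Cons.prems[of "Suc k"] by simp
  then obtain ks q where run: "queue_run ks q w" using Cons.IH by blast
  show ?case
  proof (cases c)
    case X
    with run show ?thesis by (blast intro: queue_run.X)
  next
    case Y
    \<comment> \<open>After this \<open>Y\<close> there are more letters \<open>Z\<close> than
      \<open>Y\<close>, and the surplus is the number of \<open>Z\<close> in the queue.\<close>
    with Cons.prems[of 0] have "count_list w Y < count_list w Z" by simp
    with queue_run_count_Z[OF run] have "count_list q Z \<noteq> 0" by simp
    then have "Z \<in> set q" by (metis count_list_0_iff)
    then obtain q' r where q: "q = q' @ Z # r" "Z \<notin> set r" by (meson split_list_last)
    with queue_run_set[OF run] have "\<forall>x \<in> set r. x = W" by auto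
    then have "replicate (length r) W = r" by (rule replicate_length_same)
    with run q Y show ?thesis by (metis queue_run.Y)
  next
    case Z
    with run show ?thesis by (blast intro: queue_run.pop)
  next
    case W
    with run show ?thesis by (blast intro: queue_run.pop)
  qed
qed

section \<open>Skew words and Lukasiewicz words\<close>

lemma queue_run_Luk_imp_skew_words:
  assumes "ks \<in> Luk (a + b + 2 * i - 2) (i + 1) (b - 2)" "queue_run ks [] w" "2 \<le> a" "2 \<le> b"
  shows "w \<in> skew_words a i b"
proof -
  note run = assms(2)
  let ?nz = "filter (\<lambda>k. 0 < k) ks" and ?ZW = "filter (\<lambda>c. c = Z \<or> c = W) w"
  have ks: "length ks = a + b + 2 * i - 2" "length (filter (\<lambda>k. 2 \<le> k) ks) = i + 1"
    "length (filter (\<lambda>k. k = 1) ks) = b - 2" "last ?nz \<noteq> 1"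
    using assms(1) by (auto simp: Luk_def)
  have X: "count_list w X = b - 2" using queue_run_count_X[OF run] ks by simp
  have Y: "count_list w Y = i + 1" using queue_run_count_Y[OF run] ks by simp
  have Z: "count_list w Z = i + 1" using queue_run_count_Z[OF run] Y by simp
  \<comment> \<open>The number of \<open>W\<close> is what the other letters leave of the
    length.\<close>
  have W: "count_list w W = a - 2"
    using X Y Z length_eq_count_letters[of w] queue_run_length[OF run] ks(1) assms(3,4) by simp
  have "?nz \<noteq> []" using ks(2) filter_ge_2_neq_Nil[of ks] by force
  then have "last (filter (\<lambda>c. c = X \<or> c = Y) w) = Y"
    using ks(4) by (simp add: queue_run_filter_XY[OF run] last_map)
  moreover have "Z \<in> set ?ZW" using Z count_list_0_iff[of w Z] by force
  then have "hd ?ZW = Z" using queue_run_filter_ZW[OF run] by force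
  ultimately show ?thesis
    using X Y Z W queue_run_count_prefix[OF run] by (simp add: skew_words_def)
qed

lemma skew_words_imp_queue_run:
  assumes "w \<in> skew_words a i b" "2 \<le> a" "2 \<le> b"
  shows "\<exists>ks \<in> Luk (a + b + 2 * i - 2) (i + 1) (b - 2). queue_run ks [] w"
proof -
  let ?ZW = "filter (\<lambda>c. c = Z \<or> c = W) w"
  have w: "count_list w X = b - 2" "count_list w Y = i + 1" "count_list w Z = i + 1"
    "count_list w W = a - 2" "\<And>k. count_list (take k w) Z \<le> count_list (take k w) Y"
    "hd ?ZW = Z" "last (filter (\<lambda>c. c = X \<or> c = Y) w) = Y"
    using assms(1) by (auto simp: skew_words_def)
  \<comment> \<open>Equal totals of \<open>Y\<close> and \<open>Z\<close> turn the prefix condition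
    into the suffix condition.\<close>
  have "count_list (drop k w) Y \<le> count_list (drop k w) Z" for k
  proof -
    have "count_list w c = count_list (take k w) c + count_list (drop k w) c" for c
      by (metis append_take_drop_id count_list_append)
    from this[of Y] this[of Z] w(2,3) w(5)[of k] show ?thesis by linarith
  qed
  then obtain ks q where run: "queue_run ks q w" using queue_run_path_exists by blast
  have "count_list q Z = 0" using queue_run_count_Z[OF run] w(2,3) by simp
  then have "Z \<notin> set q" by (simp add: count_list_0_iff)
  \<comment> \<open>A nonempty initial queue would be written first and holds no \<open>Z\<close>,
    but the first of the letters \<open>Z\<close> and \<open>W\<close> in \<open>w\<close> is a
    \<open>Z\<close>.\<close>
  then have "q = []" using queue_run_filter_ZW[OF run] w(6) by (cases q) auto
  let ?nz = "filter (\<lambda>k. 0 < k) ks"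
  have Y: "length (filter (\<lambda>k. 2 \<le> k) ks) = i + 1" using queue_run_count_Y[OF run] w(2) by simp
  have "?nz \<noteq> []" using Y filter_ge_2_neq_Nil[of ks] by force
  then have "last ?nz \<noteq> 1" using w(7) by (auto simp: queue_run_filter_XY[OF run] last_map)
  moreover have "length ks = a + b + 2 * i - 2"
    using w(1-4) length_eq_count_letters[of w] queue_run_length[OF run] assms(2,3) by simp
  ultimately have "ks \<in> Luk (a + b + 2 * i - 2) (i + 1) (b - 2)"
    using Y queue_run_count_X[OF run] w(1) queue_run_lukasiewicz[OF run] \<open>q = []\<close>
    by (simp add: Luk_def)
  with run \<open>q = []\<close> show ?thesis by blast
qed

text \<open>\<open>queue_run\<close> with empty initial queue is a one-to-one relation between the
  two sets, and \<open>SOME\<close> makes it a function.\<close>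

lemma bij_betw_skew_words_Luk:
  assumes "2 \<le> a" "2 \<le> b"
  shows "\<exists>f. bij_betw f (skew_words a i b) (Luk (a + b + 2 * i - 2) (i + 1) (b - 2))"
proof
  let ?L = "Luk (a + b + 2 * i - 2) (i + 1) (b - 2)"
  let ?f = "\<lambda>w. SOME ks. ks \<in> ?L \<and> queue_run ks [] w"
  have f: "?f w \<in> ?L \<and> queue_run (?f w) [] w" if "w \<in> skew_words a i b" for w
    by (rule someI_ex) (use skew_words_imp_queue_run[OF that assms] in blast)
  show "bij_betw ?f (skew_words a i b) ?L"
  proof (rule bij_betw_imageI)
    show "inj_on ?f (skew_words a i b)"
    proof (rule inj_onI)
      fix w w' assume w: "w \<in> skew_words a i b" "w' \<in> skew_words a i b" "?f w = ?f w'"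
      then have "queue_run (?f w) [] w" "queue_run (?f w) [] w'"
        using f[OF w(1)] f[OF w(2)] by simp_all
      then show "w = w'" by (rule queue_run_word_unique)
    qed
    show "?f ` skew_words a i b = ?L"
    proof (intro equalityI subsetI)
      fix ks assume "ks \<in> ?f ` skew_words a i b"
      then show "ks \<in> ?L" using f by blast
    next
      fix ks assume ks: "ks \<in> ?L"
      then obtain w where run: "queue_run ks [] w"
        using queue_run_word_exists[of "[]" ks] by (auto simp: Luk_def)
      then have w: "w \<in> skew_words a i b" using ks queue_run_Luk_imp_skew_words assms by blast
      then have "?f w = ks" using f run queue_run_path_unique by blast
      with w show "ks \<in> ?f ` skew_words a i b" by blast
    qed
  qed
qed

section \<open>Skew fillings\<close>

definition positions :: "'a list \<Rightarrow> 'a \<Rightarrow> nat list" where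
  "positions w c = filter (\<lambda>p. w ! p = c) [0..<length w]"

lemma set_positions: "set (positions w c) = {p. p < length w \<and> w ! p = c}"
  by (auto simp: positions_def)

lemma sorted_wrt_positions: "sorted_wrt (<) (positions w c)"
  unfolding positions_def by (intro sorted_wrt_filter sorted_wrt_upt)

lemma distinct_positions: "distinct (positions w c)"
  unfolding positions_def by simp

lemma length_positions: "length (positions w c) = count_list w c"
proof -
  have "length (positions w c) = card {p. p < length w \<and> w ! p = c}"
    using distinct_card[OF distinct_positions[of w c]] by (simp add: set_positions)
  also have "\<dots> = length (filter (\<lambda>x. x = c) w)" by (simp add: length_filter_conv_card)
  also have "\<dots> = count_list w c" by (induction w) auto
  finally show ?thesis .
qed

text \<open>Translates comparisons of positions into counts over prefixes: the increasing list of
  positions splits at \<open>k\<close>, and its first part is the list for the prefix.\<close>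

lemma positions_nth_less_iff:
  assumes "j < count_list w c" "k \<le> length w"
  shows "positions w c ! j < k \<longleftrightarrow> j < count_list (take k w) c"
proof -
  have "[0..<length w] = [0..<k] @ [k..<length w]"
    using assms(2) upt_add_eq_append[of 0 k "length w - k"] by simp
  moreover have "filter (\<lambda>p. w ! p = c) [0..<k] = positions (take k w) c"
    using assms(2) unfolding positions_def by (auto intro!: filter_cong)
  ultimately have split: "positions w c =
      positions (take k w) c @ filter (\<lambda>p. w ! p = c) [k..<length w]"
    unfolding positions_def by simp
  show ?thesis
  proof (cases "j < count_list (take k w) c")
    case True
    then have "positions w c ! j \<in> set (positions (take k w) c)"
      unfolding split by (simp add: nth_append length_positions)
    then show ?thesis using True by (simp add: set_positions)
  next
    case False
    have "j < length (positions w c)" using assms(1) by (simp add: length_positions)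
    then have "positions w c ! j \<in> set (filter (\<lambda>p. w ! p = c) [k..<length w])"
      using False unfolding split
      by (simp only: nth_append length_positions if_False) (rule nth_mem, simp add: length_positions)
    then show ?thesis using False by simp
  qed
qed

lemma count_prefix_le_iff:
  assumes "count_list w Z = count_list w Y"
  shows "(\<forall>k. count_list (take k w) Z \<le> count_list (take k w) Y) \<longleftrightarrow>
    (\<forall>j < count_list w Y. positions w Y ! j < positions w Z ! j)"
proof (intro iffI allI impI)
  fix j assume le: "\<forall>k. count_list (take k w) Z \<le> count_list (take k w) Y" and j: "j < count_list w Y"
  \<comment> \<open>The shortest prefix that includes the \<open>j\<close>-th \<open>Z\<close>,
    counted from 0.\<close>
  let ?k = "Suc (positions w Z ! j)"
  have "positions w Z ! j \<in> set (positions w Z)" using j assms by (simp add: length_positions)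
  then have k: "?k \<le> length w" and Z: "w ! (positions w Z ! j) = Z" by (auto simp: set_positions)
  have "j < count_list (take ?k w) Z"
    using positions_nth_less_iff[OF _ k, of j Z] j assms by simp
  also have "\<dots> \<le> count_list (take ?k w) Y" using le by blast
  finally have "positions w Y ! j < ?k" using positions_nth_less_iff[OF j k] by simp
  moreover have "positions w Y ! j \<in> set (positions w Y)" using j by (simp add: length_positions)
  then have "w ! (positions w Y ! j) = Y" by (simp add: set_positions)
  \<comment> \<open>The bound \<open>?k\<close> gives only a weak inequality; it is strict because
    the two positions carry different letters.\<close>
  ultimately show "positions w Y ! j < positions w Z ! j" using Z by (cases "positions w Y ! j = positions w Z ! j") auto
next
  fix k assume less: "\<forall>j < count_list w Y. positions w Y ! j < positions w Z ! j"
  have *: "count_list (take k w) Z \<le> count_list (take k w) Y" if k: "k \<le> length w" for k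
  proof (cases "count_list (take k w) Z")
    case (Suc j)
    have "count_list w Z = count_list (take k w) Z + count_list (drop k w) Z"
      by (metis append_take_drop_id count_list_append)
    then have j: "j < count_list w Z" using Suc by simp
    then have "positions w Z ! j < k" using positions_nth_less_iff[OF _ k] Suc by simp
    then have "positions w Y ! j < k" using less j assms by (metis less_trans)
    then have "j < count_list (take k w) Y" using positions_nth_less_iff[OF _ k] j assms by simp
    then show ?thesis using Suc by simp
  qed simp
  \<comment> \<open>Beyond the end of the word the prefix is \<open>w\<close> itself.\<close>
  show "count_list (take k w) Z \<le> count_list (take k w) Y"
    using *[of k] *[of "length w"] by (cases "k \<le> length w") auto
qed

lemma hd_filter_two_iff:
  assumes "x \<noteq> y"
  shows "x \<in> set w \<Longrightarrow> hd (filter (\<lambda>c. c = x \<or> c = y) w) = x \<longleftrightarrow>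
    (\<forall>p < length w. w ! p = y \<longrightarrow> (\<exists>p' < p. w ! p' = x))"
proof (induction w)
  case (Cons c w)
  consider "c = x" | "c = y" | "c \<noteq> x" "c \<noteq> y" by blast
  then show ?case
  proof cases
    case 1
    then show ?thesis using assms by (auto simp: All_less_Suc2)
  next
    case 2
    then show ?thesis using assms by (auto simp: All_less_Suc2)
  next
    case 3
    then show ?thesis using Cons by (simp add: All_less_Suc2 Ex_less_Suc2)
  qed
qed simp

lemma last_filter_two_iff:
  assumes "x \<noteq> y"
  shows "y \<in> set w \<Longrightarrow> last (filter (\<lambda>c. c = x \<or> c = y) w) = y \<longleftrightarrow>
    (\<forall>p < length w. w ! p = x \<longrightarrow> (\<exists>p' < length w. p < p' \<and> w ! p' = y))"
proof (induction w rule: rev_induct)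
  case (snoc c w)
  have nth: "(w @ [c]) ! p = w ! p" if "p < length w" for p using that by (simp add: nth_append)
  consider "c = x" | "c = y" | "c \<noteq> x" "c \<noteq> y" by blast
  then show ?case
  proof cases
    case 1
    then have "\<not> (\<forall>p < length (w @ [c]). (w @ [c]) ! p = x \<longrightarrow>
        (\<exists>p' < length (w @ [c]). p < p' \<and> (w @ [c]) ! p' = y))"
      by (auto intro!: exI[of _ "length w"])
    with 1 show ?thesis using assms by simp
  next
    case 2
    have "\<exists>p' < length (w @ [c]). p < p' \<and> (w @ [c]) ! p' = y"
      if "p < length (w @ [c])" "(w @ [c]) ! p = x" for p
    proof -
      have "p \<noteq> length w" using that 2 assms by auto
      then have "p < length w" using that by simp
      then show ?thesis using 2 by (intro exI[of _ "length w"]) simp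
    qed
    with 2 show ?thesis by simp
  next
    case 3
    then have IH: "last (filter (\<lambda>c. c = x \<or> c = y) w) = y \<longleftrightarrow>
      (\<forall>p < length w. w ! p = x \<longrightarrow> (\<exists>p' < length w. p < p' \<and> w ! p' = y))"
      using snoc by auto
    show ?thesis
      using 3 IH by (simp add: All_less_Suc Ex_less_Suc nth cong: conj_cong imp_cong)
  qed
qed simp

lemma positions_nth_mem:
  "j < count_list w c \<Longrightarrow> positions w c ! j < length w \<and> w ! (positions w c ! j) = c"
  using nth_mem[of j "positions w c"] by (simp add: length_positions set_positions)

lemma positions_nth_exists:
  "p < length w \<Longrightarrow> \<exists>j < count_list w (w ! p). p = positions w (w ! p) ! j"
  using in_set_conv_nth[of p "positions w (w ! p)"] by (auto simp: length_positions set_positions)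

lemma positions_nth_mono:
  "j < j' \<Longrightarrow> j' < count_list w c \<Longrightarrow> positions w c ! j < positions w c ! j'"
  using sorted_wrt_nth_less[OF sorted_wrt_positions, of j j' w c] by (simp add: length_positions)

text \<open>An \<open>x\<close> comes first among the two letters just when each \<open>y\<close> is
  preceded by some \<open>x\<close>, hence by the first one.\<close>

lemma hd_filter_positions_iff:
  assumes "x \<noteq> y" "0 < count_list w x"
  shows "hd (filter (\<lambda>c. c = x \<or> c = y) w) = x \<longleftrightarrow>
    (\<forall>j < count_list w y. positions w x ! 0 < positions w y ! j)"
proof -
  have "x \<in> set w" using assms(2) count_list_0_iff[of w x] by auto
  have first: "positions w x ! 0 \<le> p" if "p < length w" "w ! p = x" for p
    using positions_nth_exists[OF that(1)] positions_nth_mono[of 0 _ w x] that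
    by (metis gr0I less_imp_le order_refl)
  show ?thesis
    unfolding hd_filter_two_iff[OF assms(1) \<open>x \<in> set w\<close>]
  proof (intro iffI allI impI)
    fix j assume h: "\<forall>p < length w. w ! p = y \<longrightarrow> (\<exists>p' < p. w ! p' = x)" and j: "j < count_list w y"
    from h positions_nth_mem[OF j] obtain p' where "p' < positions w y ! j" "w ! p' = x" by blast
    then show "positions w x ! 0 < positions w y ! j"
      using first[of p'] positions_nth_mem[OF j] by simp
  next
    fix p assume h: "\<forall>j < count_list w y. positions w x ! 0 < positions w y ! j"
      and p: "p < length w" "w ! p = y"
    then have "positions w x ! 0 < p" using positions_nth_exists[OF p(1)] by auto
    then show "\<exists>p' < p. w ! p' = x" using positions_nth_mem[OF assms(2)] by blast
  qed
qed

text \<open>Mirror image of the previous lemma. With \<open>Suc i\<close> occurrences, index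
  \<open>i\<close> is the last \<open>y\<close>.\<close>

lemma last_filter_positions_iff:
  assumes "x \<noteq> y" "count_list w y = Suc i"
  shows "last (filter (\<lambda>c. c = x \<or> c = y) w) = y \<longleftrightarrow>
    (\<forall>j < count_list w x. positions w x ! j < positions w y ! i)"
proof -
  have i: "i < count_list w y" using assms(2) by simp
  have "y \<in> set w" using assms(2) count_list_0_iff[of w y] by auto
  have last: "p \<le> positions w y ! i" if p: "p < length w" "w ! p = y" for p
  proof -
    obtain j where j: "j < Suc i" "p = positions w y ! j"
      using positions_nth_exists[OF p(1)] p(2) assms(2) by auto
    then show ?thesis using positions_nth_mono[OF _ i, of j] by (cases "j = i") auto
  qed
  show ?thesis
    unfolding last_filter_two_iff[OF assms(1) \<open>y \<in> set w\<close>]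
  proof (intro iffI allI impI)
    fix j assume h: "\<forall>p < length w. w ! p = x \<longrightarrow> (\<exists>p' < length w. p < p' \<and> w ! p' = y)"
      and j: "j < count_list w x"
    from h positions_nth_mem[OF j] obtain p' where
      "p' < length w" "positions w x ! j < p'" "w ! p' = y" by blast
    then show "positions w x ! j < positions w y ! i" using last[of p'] by simp
  next
    fix p assume h: "\<forall>j < count_list w x. positions w x ! j < positions w y ! i"
      and p: "p < length w" "w ! p = x"
    then have "p < positions w y ! i" using positions_nth_exists[OF p(1)] by auto
    then show "\<exists>p' < length w. p < p' \<and> w ! p' = y" using positions_nth_mem[OF i] by blast
  qed
qed

section \<open>Boxes of the skew shape\<close>

locale skew_shape =
  fixes a i b :: nat
  assumes a: "2 \<le> a" and b: "2 \<le> b"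
begin

fun cnt :: "letter \<Rightarrow> nat" where
  "cnt X = b - 2" | "cnt Y = i + 1" | "cnt Z = i + 1" | "cnt W = a - 2"

text \<open>\<open>j\<close> counts from 0 in the direction in which the entries of the part
  increase: downwards for \<open>X\<close> and \<open>W\<close>, to the right for \<open>Y\<close>
  and \<open>Z\<close>.\<close>

fun box :: "letter \<Rightarrow> nat \<Rightarrow> nat \<times> nat" where
  "box X j = (j + 1, i + 1)"
| "box Y j = (b - 1, j + 1)"
| "box Z j = (b, j + 1)"
| "box W j = (b + 1 + j, 1)"

fun label :: "nat \<times> nat \<Rightarrow> letter" where
  "label (r, c) = (if r < b - 1 then X else if r = b - 1 then Y else if r = b then Z else W)"

fun index :: "nat \<times> nat \<Rightarrow> nat" where
  "index (r, c) = (if r < b - 1 then r - 1 else if r \<le> b then c - 1 else r - b - 1)"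

definition S :: "(nat \<times> nat) set" where
  "S = skew_diagram (replicate b (i + 1) @ replicate (a - 2) 1) (replicate (b - 2) i)"

lemma label_box: "j < cnt c \<Longrightarrow> label (box c j) = c"
  using b by (cases c) auto

lemma index_box: "j < cnt c \<Longrightarrow> index (box c j) = j"
  using b by (cases c) auto

lemma mem_S_iff:
  "(r, c) \<in> S \<longleftrightarrow> 1 \<le> r \<and> (r < b - 1 \<and> c = i + 1 \<or>
     (r = b - 1 \<or> r = b) \<and> 1 \<le> c \<and> c \<le> i + 1 \<or> b < r \<and> r < a + b - 1 \<and> c = 1)"
  using a b unfolding S_def skew_diagram_def young_diagram_def
  by (auto simp: nth_append split: if_splits)

lemma box_mem_S: "j < cnt c \<Longrightarrow> box c j \<in> S"
  using a b by (cases c) (auto simp: mem_S_iff)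

lemma S_boxE:
  assumes "x \<in> S"
  obtains j where "j < cnt (label x)" "x = box (label x) j" "index x = j"
proof -
  obtain r c where x: "x = (r, c)" by (cases x)
  have "index x < cnt (label x) \<and> x = box (label x) (index x)"
    using assms a b unfolding x mem_S_iff by auto
  then show thesis using that by blast
qed

lemma bij_betw_box: "bij_betw (\<lambda>(c, j). box c j) (SIGMA c:UNIV. {..<cnt c}) S"
proof (rule bij_betw_byWitness[where f' = "\<lambda>x. (label x, index x)"])
  show "\<forall>y \<in> SIGMA c:UNIV. {..<cnt c}. (\<lambda>x. (label x, index x)) ((\<lambda>(c, j). box c j) y) = y"
    by (auto simp: label_box index_box)
  show "\<forall>x \<in> S. (\<lambda>(c, j). box c j) (label x, index x) = x"
    by (auto elim!: S_boxE)
  show "(\<lambda>(c, j). box c j) ` (SIGMA c:UNIV. {..<cnt c}) \<subseteq> S"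
    by (auto simp: box_mem_S)
  show "(\<lambda>x. (label x, index x)) ` S \<subseteq> (SIGMA c:UNIV. {..<cnt c})"
    by (auto elim!: S_boxE)
qed

lemma UNIV_letter: "(UNIV :: letter set) = {X, Y, Z, W}"
  using letter.exhaust by blast

lemma card_S: "card S = cnt X + cnt Y + cnt Z + cnt W"
  using bij_betw_same_card[OF bij_betw_box] by (simp add: card_SigmaI UNIV_letter)

text \<open>Within each part the entries form a chain. Between different parts the three listed
  families of comparisons imply all others by transitivity.\<close>

lemma mem_Skyt_iff:
  "f \<in> Skyt a i b \<longleftrightarrow> f \<in> extensional S \<and> bij_betw f S {1..card S} \<and>
     (\<forall>c j j'. j < j' \<and> j' < cnt c \<longrightarrow> f (box c j) < f (box c j')) \<and>
     (\<forall>j < cnt Y. f (box Y j) < f (box Z j)) \<and>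
     (\<forall>j < cnt W. f (box Z 0) < f (box W j)) \<and>
     (\<forall>j < cnt X. f (box X j) < f (box Y i))" (is "?L \<longleftrightarrow> ?R")
proof
  assume f: ?L
  have row: "f (r, c) < f (r, c')" if "(r, c) \<in> S" "(r, c') \<in> S" "c < c'" for r c c'
    using f that unfolding Skyt_def standard_fillings_def S_def by blast
  have col: "f (r, c) < f (r', c)" if "(r, c) \<in> S" "(r', c) \<in> S" "r < r'" for r r' c
    using f that unfolding Skyt_def standard_fillings_def S_def by blast
  have "f (box c j) < f (box c j')" if "j < j'" "j' < cnt c" for c j j'
    using that box_mem_S[of j c] box_mem_S[of j' c] row col by (cases c) auto
  moreover have "f (box Y j) < f (box Z j)" if "j < cnt Y" for j
    using that box_mem_S[of j Y] box_mem_S[of j Z] col b by auto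
  moreover have "f (box Z 0) < f (box W j)" if "j < cnt W" for j
    using that box_mem_S[of 0 Z] box_mem_S[of j W] col by auto
  moreover have "f (box X j) < f (box Y i)" if "j < cnt X" for j
    using that box_mem_S[of j X] box_mem_S[of i Y] col by auto
  moreover have "f \<in> extensional S" "bij_betw f S {1..card S}"
    using f unfolding Skyt_def standard_fillings_def S_def by blast+
  ultimately show ?R by blast
next
  assume f: ?R
  then have chain: "\<And>c j j'. j < j' \<Longrightarrow> j' < cnt c \<Longrightarrow> f (box c j) < f (box c j')"
    and yz: "\<And>j. j < cnt Y \<Longrightarrow> f (box Y j) < f (box Z j)"
    and zw: "\<And>j. j < cnt W \<Longrightarrow> f (box Z 0) < f (box W j)"
    and xy: "\<And>j. j < cnt X \<Longrightarrow> f (box X j) < f (box Y i)"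
    by blast+
  have "f (r, c) < f (r, c')" if rc: "(r, c) \<in> S" "(r, c') \<in> S" "c < c'" for r c c'
  proof -
    \<comment> \<open>Only the two long rows can contain two boxes.\<close>
    have "r = b - 1 \<or> r = b" and c: "1 \<le> c" "c' \<le> i + 1" using rc unfolding mem_S_iff by auto
    then show ?thesis
      using chain[of "c - 1" "c' - 1" Y] chain[of "c - 1" "c' - 1" Z] rc(3) by auto
  qed
  moreover have "f (r, c) < f (r', c)" if rc: "(r, c) \<in> S" "(r', c) \<in> S" "r < r'" for r r' c
  proof -
    obtain l j where j: "j < cnt l" "(r, c) = box l j" using S_boxE[OF rc(1)] by metis
    obtain l' j' where j': "j' < cnt l'" "(r', c) = box l' j'" using S_boxE[OF rc(2)] by metis
    have less: "fst (box l j) < fst (box l' j')" and eq: "snd (box l j) = snd (box l' j')"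
      unfolding j(2)[symmetric] j'(2)[symmetric] using rc(3) by simp_all
    consider (XZ) "l = X" "l' = Z" | (XW) "l = X" "l' = W" | (WX) "l = W" "l' = X"
      | (other) "l = X \<longrightarrow> l' \<noteq> Z \<and> l' \<noteq> W" "l = W \<longrightarrow> l' \<noteq> X" by blast
    then have "f (box l j) < f (box l' j')"
    proof cases
      case XZ
      then have "j' = i" using eq by simp
      then show ?thesis using xy[of j] yz[of i] XZ j(1) by simp
    next
      case XW
      \<comment> \<open>A common column of \<open>X\<close> and \<open>W\<close> means
        \<open>i = 0\<close>, so that the last \<open>Z\<close> is the first.\<close>
      then have "box Z i = box Z 0" using eq by simp
      moreover have "f (box Y i) < f (box Z i)" using yz[of i] by simp
      ultimately have "f (box Y i) < f (box Z 0)" by (simp only:)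
      then show ?thesis using xy[of j] zw[of j'] XW j(1) j'(1) by (metis less_trans)
    next
      case WX
      \<comment> \<open>Boxes of \<open>W\<close> lie below all boxes of \<open>X\<close>, so this
        order of rows is impossible.\<close>
      then have "b + 1 + j < j' + 1" "j' < b - 2" using less j'(1) by simp_all
      then show ?thesis by simp
    next
      case other
      then show ?thesis
        using less eq j(1) j'(1) b chain[of j j' l] xy[of j] yz[of j] zw[of j']
        by (cases l; cases l') auto
    qed
    then show ?thesis unfolding j(2) j'(2) .
  qed
  ultimately show ?L using f unfolding Skyt_def standard_fillings_def S_def by blast
qed

text \<open>Puts the conditions into the form of \<open>mem_Skyt_iff\<close>, with positions in
  place of entries. The chains have no counterpart, as the positions of one letter always
  increase.\<close>

lemma mem_skew_words_iff:
  "w \<in> skew_words a i b \<longleftrightarrow> (\<forall>c. count_list w c = cnt c) \<and>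
     (\<forall>j < cnt Y. positions w Y ! j < positions w Z ! j) \<and>
     (\<forall>j < cnt W. positions w Z ! 0 < positions w W ! j) \<and>
     (\<forall>j < cnt X. positions w X ! j < positions w Y ! i)" (is "?L \<longleftrightarrow> ?R")
proof -
  have all: "(\<forall>c. count_list w c = cnt c) \<longleftrightarrow> count_list w X = b - 2 \<and> count_list w Y = i + 1 \<and>
      count_list w Z = i + 1 \<and> count_list w W = a - 2" (is "?A \<longleftrightarrow> ?B")
  proof
    assume ?B
    then have "count_list w c = cnt c" for c by (cases c) simp_all
    then show ?A by blast
  qed simp
  show ?thesis
  proof (cases ?A)
    case True
    then have cnt: "count_list w X = cnt X" "count_list w Y = cnt Y" "count_list w Z = cnt Z"
      "count_list w W = cnt W" by blast+
    have "(\<forall>k. count_list (take k w) Z \<le> count_list (take k w) Y) \<longleftrightarrow>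
        (\<forall>j < cnt Y. positions w Y ! j < positions w Z ! j)"
      using count_prefix_le_iff[of w] cnt by simp
    moreover have "hd (filter (\<lambda>c. c = Z \<or> c = W) w) = Z \<longleftrightarrow>
        (\<forall>j < cnt W. positions w Z ! 0 < positions w W ! j)"
      using hd_filter_positions_iff[of Z W w] cnt by simp
    moreover have "last (filter (\<lambda>c. c = X \<or> c = Y) w) = Y \<longleftrightarrow>
        (\<forall>j < cnt X. positions w X ! j < positions w Y ! i)"
      using last_filter_positions_iff[of X Y w i] cnt by simp
    ultimately show ?thesis
      using True all unfolding skew_words_def mem_Collect_eq by blast
  next
    case False
    then show ?thesis using all unfolding skew_words_def mem_Collect_eq by blast
  qed
qed

section \<open>Passing between fillings and words\<close>

definition filling_word :: "(nat \<times> nat \<Rightarrow> nat) \<Rightarrow> letter list" where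
  "filling_word f = map (\<lambda>p. label (inv_into S f (Suc p))) [0..<card S]"

text \<open>Inverse to \<open>filling_word\<close>. Entries start at 1 and positions at 0, hence
  \<open>Suc\<close> in both; restricting to \<open>S\<close> makes the filling extensional.\<close>

definition word_filling :: "letter list \<Rightarrow> nat \<times> nat \<Rightarrow> nat" where
  "word_filling w = restrict (\<lambda>x. Suc (positions w (label x) ! index x)) S"

text \<open>Both lists are strictly increasing and have the same elements. This identity turns
  comparisons of entries into comparisons of positions.\<close>

lemma positions_filling_word:
  assumes f: "f \<in> Skyt a i b"
  shows "positions (filling_word f) c = map (\<lambda>j. f (box c j) - 1) [0..<cnt c]"
proof (rule sorted_distinct_set_unique)
  have bij: "bij_betw f S {1..card S}"
    and chain: "\<And>j j'. j < j' \<Longrightarrow> j' < cnt c \<Longrightarrow> f (box c j) < f (box c j')"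
    using f unfolding mem_Skyt_iff by blast+
  have range: "1 \<le> f x \<and> f x \<le> card S" if "x \<in> S" for x
    using bij that bij_betwE by fastforce
  show "sorted (positions (filling_word f) c)" "distinct (positions (filling_word f) c)"
    unfolding positions_def by (simp_all add: sorted_wrt_filter)
  have "sorted_wrt (<) (map (\<lambda>j. f (box c j) - 1) [0..<cnt c])"
    unfolding sorted_wrt_iff_nth_less
  proof (intro allI impI)
    fix j j' assume j: "j < j'" "j' < length (map (\<lambda>j. f (box c j) - 1) [0..<cnt c])"
    then have "f (box c j) < f (box c j')" using chain by simp
    moreover have "1 \<le> f (box c j)" using range[OF box_mem_S[of j c]] j by simp
    ultimately show "map (\<lambda>j. f (box c j) - 1) [0..<cnt c] ! j <
        map (\<lambda>j. f (box c j) - 1) [0..<cnt c] ! j'" using j by simp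
  qed
  then show "sorted (map (\<lambda>j. f (box c j) - 1) [0..<cnt c])"
    "distinct (map (\<lambda>j. f (box c j) - 1) [0..<cnt c])"
    unfolding strict_sorted_iff by blast+
  have "p \<in> set (positions (filling_word f) c) \<longleftrightarrow>
      p \<in> set (map (\<lambda>j. f (box c j) - 1) [0..<cnt c])" for p
  proof
    assume "p \<in> set (positions (filling_word f) c)"
    then have p: "p < card S" "label (inv_into S f (Suc p)) = c"
      by (auto simp: set_positions filling_word_def)
    then have img: "Suc p \<in> f ` S" using bij by (auto simp: bij_betw_def)
    let ?x = "inv_into S f (Suc p)"
    have x: "?x \<in> S" "f ?x = Suc p" using inv_into_into[OF img] f_inv_into_f[OF img] by auto
    then obtain j where "j < cnt c" "?x = box c j" using p S_boxE by metis
    then show "p \<in> set (map (\<lambda>j. f (box c j) - 1) [0..<cnt c])"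
      using x by (auto intro!: image_eqI[of _ _ j])
  next
    assume "p \<in> set (map (\<lambda>j. f (box c j) - 1) [0..<cnt c])"
    then obtain j where j: "j < cnt c" "p = f (box c j) - 1" by auto
    then have "Suc p = f (box c j)" "p < card S" using range[OF box_mem_S[OF j(1)]] by auto
    moreover have "inv_into S f (f (box c j)) = box c j"
      using bij box_mem_S[OF j(1)] by (auto simp: bij_betw_def)
    ultimately show "p \<in> set (positions (filling_word f) c)"
      using label_box[OF j(1)] by (simp add: set_positions filling_word_def)
  qed
  then show "set (positions (filling_word f) c) = set (map (\<lambda>j. f (box c j) - 1) [0..<cnt c])"
    by blast
qed

lemma filling_word_mem_skew_words:
  assumes f: "f \<in> Skyt a i b"
  shows "filling_word f \<in> skew_words a i b"
proof -
  have len: "count_list (filling_word f) c = cnt c" for c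
    using arg_cong[OF positions_filling_word[OF f, of c], of length] by (simp add: length_positions)
  have nth: "positions (filling_word f) c ! j = f (box c j) - 1" if "j < cnt c" for c j
    using that by (simp add: positions_filling_word[OF f])
  have pos: "0 < f (box c j)" if "j < cnt c" for c j
  proof -
    have "bij_betw f S {1..card S}" using f unfolding mem_Skyt_iff by blast
    then show ?thesis using box_mem_S[OF that] bij_betwE by fastforce
  qed
  \<comment> \<open>Entries are positive, so subtracting 1 preserves strict inequalities.\<close>
  have dec: "f (box c j) - 1 < f (box c' j') - 1" if "f (box c j) < f (box c' j')" "j < cnt c" for c c' j j'
    using that pos[of j c] by simp
  show ?thesis
    unfolding mem_skew_words_iff
  proof (intro conjI allI impI)
    fix c show "count_list (filling_word f) c = cnt c" by (rule len)
  next
    fix j assume j: "j < cnt Y"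
    then have "f (box Y j) < f (box Z j)" using f unfolding mem_Skyt_iff by blast
    moreover have "j < cnt Z" using j by simp
    ultimately show "positions (filling_word f) Y ! j < positions (filling_word f) Z ! j"
      using dec j nth by metis
  next
    fix j assume j: "j < cnt W"
    then have "f (box Z 0) < f (box W j)" using f unfolding mem_Skyt_iff by blast
    moreover have "0 < cnt Z" by simp
    ultimately show "positions (filling_word f) Z ! 0 < positions (filling_word f) W ! j"
      using dec j nth by metis
  next
    fix j assume j: "j < cnt X"
    then have "f (box X j) < f (box Y i)" using f unfolding mem_Skyt_iff by blast
    moreover have "i < cnt Y" by simp
    ultimately show "positions (filling_word f) X ! j < positions (filling_word f) Y ! i"
      using dec j nth by metis
  qed
qed

lemma word_filling_filling_word:
  assumes f: "f \<in> Skyt a i b"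
  shows "word_filling (filling_word f) = f"
proof
  fix x
  show "word_filling (filling_word f) x = f x"
  proof (cases "x \<in> S")
    case True
    then obtain j where j: "j < cnt (label x)" "x = box (label x) j" "index x = j" by (rule S_boxE)
    have "bij_betw f S {1..card S}" using f unfolding mem_Skyt_iff by blast
    then have "0 < f x" using True bij_betwE by fastforce
    moreover have "positions (filling_word f) (label x) ! index x = f x - 1"
      unfolding positions_filling_word[OF f] using j by simp
    ultimately show ?thesis using True by (simp add: word_filling_def)
  next
    case False
    moreover have "f \<in> extensional S" using f unfolding mem_Skyt_iff by blast
    ultimately have "f x = undefined" by (intro extensional_arb)
    with False show ?thesis by (simp add: word_filling_def)
  qed
qed

lemma word_filling_box:
  "j < cnt c \<Longrightarrow> word_filling w (box c j) = Suc (positions w c ! j)"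
  using label_box index_box box_mem_S by (simp add: word_filling_def)

lemma length_eq_card_S:
  assumes "w \<in> skew_words a i b"
  shows "length w = card S"
proof -
  have "count_list w c = cnt c" for c using assms unfolding mem_skew_words_iff by blast
  then show ?thesis unfolding card_S length_eq_count_letters[of w] by (simp only:)
qed

lemma word_filling_nth:
  assumes w: "w \<in> skew_words a i b" and x: "x \<in> S"
  shows "\<exists>p < length w. word_filling w x = Suc p \<and> w ! p = label x"
proof -
  obtain j where j: "j < cnt (label x)" "x = box (label x) j" using S_boxE[OF x] by metis
  then have "j < count_list w (label x)" using w unfolding mem_skew_words_iff by simp
  then show ?thesis using positions_nth_mem word_filling_box[OF j(1), of w] j(2) by metis
qed

lemma bij_betw_word_filling:
  assumes w: "w \<in> skew_words a i b"
  shows "bij_betw (word_filling w) S {1..card S}"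
proof (rule bij_betw_imageI)
  show inj: "inj_on (word_filling w) S"
  proof (rule inj_onI)
    fix x x' assume x: "x \<in> S" "x' \<in> S" "word_filling w x = word_filling w x'"
    \<comment> \<open>Equal entries mean the same position, and its letter names the part containing
      the box.\<close>
    then have lab: "label x = label x'"
      using word_filling_nth[OF w, of x] word_filling_nth[OF w, of x'] by auto
    obtain j where j: "j < cnt (label x)" "x = box (label x) j" using S_boxE[OF x(1)] by metis
    obtain j' where j': "j' < cnt (label x)" "x' = box (label x) j'"
      using S_boxE[OF x(2)] lab by metis
    have "positions w (label x) ! j = positions w (label x) ! j'"
      using x(3) word_filling_box j j' by (metis nat.inject)
    moreover have "length (positions w (label x)) = cnt (label x)"
      using w unfolding mem_skew_words_iff by (simp add: length_positions)
    ultimately have "j = j'" using j j' by (simp add: nth_eq_iff_index_eq distinct_positions)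
    then show "x = x'" using j j' by simp
  qed
  have "word_filling w ` S \<subseteq> {1..card S}"
    using word_filling_nth[OF w] length_eq_card_S[OF w] by fastforce
  then show "word_filling w ` S = {1..card S}"
    using card_image[OF inj] by (intro card_subset_eq) auto
qed

lemma word_filling_mem_Skyt:
  assumes w: "w \<in> skew_words a i b"
  shows "word_filling w \<in> Skyt a i b"
  unfolding mem_Skyt_iff
proof (intro conjI allI impI)
  show "word_filling w \<in> extensional S" unfolding word_filling_def by simp
  show "bij_betw (word_filling w) S {1..card S}" by (rule bij_betw_word_filling[OF w])
next
  fix c j j' assume j: "j < j' \<and> j' < cnt c"
  then have "positions w c ! j < positions w c ! j'"
    using w positions_nth_mono[of j j' w c] unfolding mem_skew_words_iff by simp
  then show "word_filling w (box c j) < word_filling w (box c j')"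
    using j word_filling_box[of j c w] word_filling_box[of j' c w] by simp
next
  fix j assume j: "j < cnt Y"
  then have "positions w Y ! j < positions w Z ! j" using w unfolding mem_skew_words_iff by blast
  then show "word_filling w (box Y j) < word_filling w (box Z j)"
    using j word_filling_box[of j Y w] word_filling_box[of j Z w] by simp
next
  fix j assume j: "j < cnt W"
  then have "positions w Z ! 0 < positions w W ! j" using w unfolding mem_skew_words_iff by blast
  then show "word_filling w (box Z 0) < word_filling w (box W j)"
    using j word_filling_box[of 0 Z w] word_filling_box[of j W w] by simp
next
  fix j assume j: "j < cnt X"
  then have "positions w X ! j < positions w Y ! i" using w unfolding mem_skew_words_iff by blast
  then show "word_filling w (box X j) < word_filling w (box Y i)"
    using j word_filling_box[of j X w] word_filling_box[of i Y w] by simp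
qed

lemma filling_word_word_filling:
  assumes w: "w \<in> skew_words a i b"
  shows "filling_word (word_filling w) = w"
proof (rule nth_equalityI)
  show "length (filling_word (word_filling w)) = length w"
    using length_eq_card_S[OF w] by (simp add: filling_word_def)
  fix p assume "p < length (filling_word (word_filling w))"
  then have p: "p < card S" by (simp add: filling_word_def)
  let ?x = "inv_into S (word_filling w) (Suc p)"
  have img: "Suc p \<in> word_filling w ` S"
    using bij_betw_word_filling[OF w] p by (auto simp: bij_betw_def)
  have "?x \<in> S" "word_filling w ?x = Suc p"
    using inv_into_into[OF img] f_inv_into_f[OF img] by auto
  then have "w ! p = label ?x" using word_filling_nth[OF w] by fastforce
  then show "filling_word (word_filling w) ! p = w ! p" using p by (simp add: filling_word_def)
qed

lemma bij_betw_Skyt_skew_words: "bij_betw filling_word (Skyt a i b) (skew_words a i b)"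
  by (rule bij_betw_byWitness[where f' = word_filling])
    (auto simp: word_filling_filling_word filling_word_word_filling
      filling_word_mem_skew_words word_filling_mem_Skyt)

end

section \<open>The bijections\<close>

theorem mainTheorem1:
  fixes a b i :: nat
  assumes "a \<ge> 2" and "b \<ge> 2"
  shows "(\<exists>f. bij_betw f (Skyt a i b) (Dyck (a + b + 2 * i - 2) (i + 1) (b - 2)))
    \<and> (\<exists>g. bij_betw g (Dyck (a + b + 2 * i - 2) (i + 1) (b - 2)) (Tri (a + b + 2 * i) (i + 1) (b - 2)))
    \<and> (\<exists>h. bij_betw h (Skyt a i b) (Tri (a + b + 2 * i) (i + 1) (b - 2)))
    \<and> card (Skyt a i b) = card (Dyck (a + b + 2 * i - 2) (i + 1) (b - 2))
    \<and> card (Dyck (a + b + 2 * i - 2) (i + 1) (b - 2)) = card (Tri (a + b + 2 * i) (i + 1) (b - 2))"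
proof -
  let ?n = "a + b + 2 * i - 2"
  let ?L = "Luk ?n (i + 1) (b - 2)" and ?D = "Dyck ?n (i + 1) (b - 2)"
    and ?T = "Tri (a + b + 2 * i) (i + 1) (b - 2)"
  interpret skew_shape a i b using assms by unfold_locales
  obtain f where f: "bij_betw f (skew_words a i b) ?L"
    using bij_betw_skew_words_Luk assms by blast
  have D: "bij_betw path ?L ?D" by (rule bij_betw_path) simp
  \<comment> \<open>The truncated subtraction in \<open>?n\<close> is exact because \<open>a\<close>
    and \<open>b\<close> are at least 2.\<close>
  have "?n + 2 = a + b + 2 * i" using assms by simp
  then obtain g where g: "bij_betw g ?L ?T"
    using bij_betw_Luk_Tri[of "i + 1" ?n "b - 2"] by auto
  \<comment> \<open>From a filling to its word of parts, then to the Lukasiewicz word, then to the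
    Dyck path.\<close>
  have SD: "bij_betw (path \<circ> (f \<circ> filling_word)) (Skyt a i b) ?D"
    using bij_betw_trans[OF bij_betw_trans[OF bij_betw_Skyt_skew_words f] D] .
  have DT: "bij_betw (g \<circ> inv_into ?L path) ?D ?T"
    using bij_betw_trans[OF bij_betw_inv_into[OF D] g] .
  show ?thesis
    using SD DT bij_betw_trans[OF SD DT] bij_betw_same_card[OF SD] bij_betw_same_card[OF DT]
    by blast
qed

end
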